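(* Let $F,\phi:\mathcal X\to\mathbb R\cup\{+\infty\}$ be proper lower semicontinuous functions such that $\inf_{x\in\mathcal X}(F+\phi)(x)>-\infty$; $F$ is locally Lipschitz continuous at every point of $\operatorname{int}(\operatorname{dom}F)$; $\operatorname{dom}F$ is convex with $\operatorname{dom}\phi\subset\operatorname{int}(\operatorname{dom}F)$; and $\phi$ is prox-bounded with threshold $\gamma_\phi\in(0,+\infty]$. Assume moreover that $F$ is lower regular at every point of $\operatorname{int}(\operatorname{dom}F)$ and $\phi$ is prox-regular at every point of $\operatorname{dom}\phi$. Let $\{F^{\langle\mu\rangle}\}_{\mu\in(0,\widetilde\mu)}$ with some $\widetilde\mu\in(0,+\infty]$ be a smoothing function of $F$, with associated constants $\kappa>0$, $\varpi_1\ge0$, $\varpi_2>0$. Choose arbitrarily $x_1\in\operatorname{dom}\phi$, $c\in(0,2^{-1})$, $\rho\in(0,1)$, $\gamma_{\rm init}\in(0,\gamma_\phi)$ and $\theta\in(0,1)$. Let $(\mu_n)_{n=1}^\infty\subset(0,\widetilde\mu)$ be nonincreasing with $\lim_{n\to\infty}\mu_n=0$ and $\sum_{n=1}^\infty\mu_n=+\infty$, put $F_n:=F^{\langle\mu_n\rangle}$, and let $(x_n)_{n=1}^\infty\subset\operatorname{dom}\phi$, with stepsizes $(\gamma_n)_{n=1}^\infty$ and reference values $(R_n)_{n=1}^\infty$, be generated by the proximal variable smoothing algorithm with nonmonotone linesearch (described in the context). Then the following hold. (a) For $\widehat R_n:=R_n+\kappa\mu_n$ and all $n\in\mathbb N$,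 $$\widehat R_n-\widehat R_{n+1}\ge\theta c\gamma_n\big(\mathcal M_{\gamma_n}^{F_n,\phi}(x_n)\big)^2\ge0,$$ $$\widehat R_n\ge(F+\phi)(x_n)\ge\inf_{x\in\mathcal X}(F+\phi)(x)>-\infty,$$ $$x_n\in\{x\in\mathcal X\mid(F+\phi)(x)\le\widehat R_1\}\subset\operatorname{dom}\phi.$$ (b) For any $(\underline k,\overline k)\in\mathbb N^2$ with $\underline k\le\overline k$, $$\sum_{n=\underline k}^{\overline k}\mu_n\big(\mathcal M_{\gamma_n}^{F_n,\phi}(x_n)\big)^2\le\chi,\qquad \min_{\underline k\le n\le\overline k}\mathcal M_{\gamma_n}^{F_n,\phi}(x_n)\le\sqrt{\frac{\chi}{\sum_{n=\underline k}^{\overline k}\mu_n}},$$ where, with $\beta:=\min\{\gamma_{\rm init}L_{\nabla F_1},\rho(1-2c)\}>0$ and $L_{\nabla F_1}=\varpi_1+\varpi_2\mu_1^{-1}$, $$\chi:=\frac{\big((F+\phi)(x_1)+\kappa\mu_1-\inf_{x\in\mathcal X}(F+\phi)(x)\big)\big(\varpi_1+\mu_1^{-1}\varpi_2\big)}{\theta c\beta\mu_1^{-1}}\in(0,+\infty).$$ In particular, if $\mu_n=\tau n^{-1/\alpha}$ $(n\in\mathbb N)$ with $\tau\in(0,\widetilde\mu)$ and $\alpha>1$, then $\min_{1\le n\le k}\mathcal M_{\gamma_n}^{F_n,\phi}(x_n)=\mathcal O\big(k^{-\frac{\alpha-1}{2\alpha}}\big)$ as $k\to\infty$. (c) $\liminf_{n\to\infty}\mathcal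 M_{\gamma_n}^{F_n,\phi}(x_n)=0$. Moreover, let $m:\mathbb N\to\mathbb N$ be monotonically increasing such that the subsequence $(x_{m(l)})_{l=1}^\infty$ satisfies $\lim_{l\to\infty}\mathcal M_{\gamma_{m(l)}}^{F_{m(l)},\phi}(x_{m(l)})=0$. Then every cluster point $\bar x\in\mathcal X$ of $(x_{m(l)})_{l=1}^\infty$ belongs to $\operatorname{dom}\phi$; and such $\bar x$ is a Fréchet stationary point of $F+\phi$ if additionally the limiting subdifferential $\partial_{\rm L}\phi$ is outer semicontinuous at every point of $\operatorname{dom}\phi$.
   Context: $\mathcal X$ is a (finite-dimensional real) Euclidean space with inner product $\langle\cdot,\cdot\rangle$ and norm $\|\cdot\|$; $B(\bar x,\delta)$ is the open ball; $\operatorname{dom}\psi=\{x:\psi(x)<+\infty\}$; proper means $\operatorname{dom}\psi\neq\emptyset$. A function is locally Lipschitz continuous at $\bar x$ if it is Lipschitz continuous on some open neighborhood of $\bar x$. $\phi$ is prox-bounded with threshold $\gamma_\phi\in(0,+\infty]$ if $\phi+\frac1{2\gamma}\|\cdot\|^2$ is bounded below for all $\gamma\in(0,\gamma_\phi)$. $\mu_n\searrow0$ means monotonically nonincreasing with limit $0$. Subdifferentials of $\psi:\mathcal X\to\mathbb R\cup\{+\infty\}$ at $\bar x\in\operatorname{dom}\psi$ (empty if $\bar x\notin\operatorname{dom}\psi$): Fréchet: $v\in\partial_{\rm F}\psi(\bar x)$ if $\liminf_{x\to\bar x,\,x\ne\bar x}\frac{\psi(x)-\psi(\bar x)-\langle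 v,x-\bar x\rangle}{\|x-\bar x\|}\ge0$; limiting: $v\in\partial_{\rm L}\psi(\bar x)$ if there are $x_n\to\bar x$ with $\psi(x_n)\to\psi(\bar x)$ and $v_n\in\partial_{\rm F}\psi(x_n)$ with $v_n\to v$. $x^\star\in\operatorname{dom}\phi$ is a Fréchet stationary point of $F+\phi$ if $0\in\partial_{\rm F}(F+\phi)(x^\star)$. $\psi$ is lower regular at $\bar x\in\operatorname{dom}\psi$ if $\partial_{\rm F}\psi(\bar x)=\partial_{\rm L}\psi(\bar x)$. $\psi$ is prox-regular at $\bar x\in\operatorname{dom}\psi$ for $\bar v\in\partial_{\rm L}\psi(\bar x)$ if there are $\delta>0$, $\eta\ge0$ such that $\psi(x')\ge\psi(x)+\langle v,x'-x\rangle-\frac\eta2\|x'-x\|^2$ for all $x'\in B(\bar x,\delta)$ whenever $x\in B(\bar x,\delta)$, $v\in\partial_{\rm L}\psi(x)\cap B(\bar v,\delta)$ and $\psi(x)<\psi(\bar x)+\delta$; $\psi$ is prox-regular at $\bar x$ if this holds for every $\bar v\in\partial_{\rm L}\psi(\bar x)$. For subsets $E_n\subset\mathcal X$, $\operatorname{Limsup}_{n\to\infty}E_n$ is the set of all $v$ that are limits of $(v_n)_{n\in N}$ with $v_n\in E_n$ along some infinite $N\subset\mathbb N$. A set-valued map $S:\mathcal X\rightrightarrows\mathcal X$ is outer semicontinuous at $\bar x$ if $\operatorname{Limsup}_{n\to\infty}S(x_n)\subset S(\bar x)$ for every sequence $x_n\to\bar x$ in $\mathcal X$. Smoothing function: a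 family $\{F^{\langle\mu\rangle}:\mathcal X\to\mathbb R\cup\{+\infty\}\}_{\mu\in(0,\widetilde\mu)}$ with $\operatorname{int}(\operatorname{dom}F^{\langle\mu\rangle})=\operatorname{int}(\operatorname{dom}F)$ for all $\mu$ is a smoothing function of $F$ if: (a) $\lim_{\mu\to0}F^{\langle\mu\rangle}(\bar x)=F(\bar x)$ for all $\bar x\in\operatorname{int}(\operatorname{dom}F)$; (b) there is $\kappa>0$ with $0\le F^{\langle\mu'\rangle}(x)-F^{\langle\mu\rangle}(x)\le\kappa(\mu-\mu')$ for all $\mu,\mu'\in(0,\widetilde\mu)$ with $\mu'\le\mu$ and all $x\in\operatorname{int}(\operatorname{dom}F)$; (c) for every $\mu$, $F^{\langle\mu\rangle}$ is continuously differentiable over $\operatorname{int}(\operatorname{dom}F)$ and $\nabla F^{\langle\mu\rangle}$ is Lipschitz continuous over $\operatorname{int}(\operatorname{dom}F)$ with a constant $L_{\nabla F^{\langle\mu\rangle}}>0$; (d) there are $\varpi_1\ge0$, $\varpi_2>0$ such that the constant in (c) is given by $L_{\nabla F^{\langle\mu\rangle}}=\varpi_1+\varpi_2\mu^{-1}$ for all $\mu\in(0,\widetilde\mu)$; (e) for every $\bar x\in\operatorname{int}(\operatorname{dom}F)$, $\partial_{\rm L}F(\bar x)$ equals the set of all $v$ for which there exist $(x_n)\subset\operatorname{int}(\operatorname{dom}F)$ and $(\mu_n)\subset(0,\widetilde\mu)$ with $x_n\to\bar x$, $\mu_n\searrow0$ and $v=\lim_{n\to\infty}\nabla F^{\langle\mu_n\rangle}(x_n)$.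 For $\gamma>0$, $\operatorname{prox}_{\gamma\phi}(\bar x)=\operatorname{argmin}_{x\in\mathcal X}\big(\phi(x)+\frac1{2\gamma}\|x-\bar x\|^2\big)$ (a set), and for $G:\mathcal X\to\mathbb R\cup\{+\infty\}$, $\mathcal M_\gamma^{G,\phi}(\bar x)=\inf\{\|(\bar x-p)/\gamma\| : p\in\operatorname{prox}_{\gamma\phi}(\bar x-\gamma v),\ v\in\partial_{\rm L}G(\bar x)\}\in[0,+\infty]$ ($\inf\emptyset=+\infty$). For $\bar x\in\operatorname{int}(\operatorname{dom}F)$, $\partial_{\rm L}F^{\langle\mu\rangle}(\bar x)=\{\nabla F^{\langle\mu\rangle}(\bar x)\}$. Algorithm (proximal variable smoothing with nonmonotone linesearch). Input: $x_1\in\operatorname{dom}\phi$, $c,\rho,\gamma_{\rm init},\theta$, $(\mu_n)$ and the smoothing function. For $n=1,2,\dots$: set $F_n=F^{\langle\mu_n\rangle}$; choose $\theta_n\in[\theta,1]$ arbitrarily and set $R_1=(F_1+\phi)(x_1)$, and for $n>1$ $$R_n=\theta_n(F_n+\phi)(x_n)+(1-\theta_n)\big(R_{n-1}+\kappa(\mu_{n-1}-\mu_n)\big).$$ Backtracking loop: for $l=0,1,2,\dots$, pick any $p\in\operatorname{prox}_{\rho^l\gamma_{\rm init}\phi}\big(x_n-\rho^l\gamma_{\rm init}\nabla F_n(x_n)\big)$ (a nonempty set); if $(F_n+\phi)(p)\le R_n-c\rho^l\gamma_{\rm init}\big\|\frac{x_n-p}{\rho^l\gamma_{\rm init}}\big\|^2$,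 set $(x_{n+1},\gamma_n)=(p,\rho^l\gamma_{\rm init})$ and leave the loop. *)

theory Defs
  imports "HOL-Analysis.Analysis" "HOL-Library.Landau_Symbols"
begin

text \<open>
  Functions into the reals with an added \<open>+\<infinity>\<close> are rendered as functions into \<^typ>\<open>ereal\<close> that
  avoid \<open>-\<infinity>\<close>; for such functions the sum on \<^typ>\<open>ereal\<close> is the usual one.
\<close>

definition edom :: "('a \<Rightarrow> ereal) \<Rightarrow> 'a set" where
  "edom \<psi> = {x. \<psi> x < \<infinity>}"

definition proper_fun :: "('a \<Rightarrow> ereal) \<Rightarrow> bool" where
  "proper_fun \<psi> \<longleftrightarrow> (\<forall>x. \<psi> x \<noteq> -\<infinity>) \<and> edom \<psi> \<noteq> {}"

definition lsc_fun :: "('a::topological_space \<Rightarrow> ereal) \<Rightarrow> bool" where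
  "lsc_fun \<psi> \<longleftrightarrow> (\<forall>x. \<psi> x \<le> Liminf (at x) \<psi>)"

definition locally_lipschitz_at :: "('a::metric_space \<Rightarrow> ereal) \<Rightarrow> 'a \<Rightarrow> bool" where
  "locally_lipschitz_at \<psi> x \<longleftrightarrow>
     (\<exists>U L. open U \<and> x \<in> U \<and> U \<subseteq> edom \<psi> \<and> L-lipschitz_on U (\<lambda>y. real_of_ereal (\<psi> y)))"

text \<open>The threshold may be \<open>+\<infinity>\<close>; it need not be the largest one with this property.\<close>

definition prox_bounded :: "('a::real_normed_vector \<Rightarrow> ereal) \<Rightarrow> ereal \<Rightarrow> bool" where
  "prox_bounded \<phi> g\<phi> \<longleftrightarrow>
     (\<forall>\<gamma>. 0 < \<gamma> \<and> ereal \<gamma> < g\<phi> \<longrightarrow>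
        (\<exists>b::real. \<forall>x. ereal b \<le> \<phi> x + ereal (1 / (2 * \<gamma>) * (norm x)\<^sup>2)))"

definition frechet_subdiff :: "('a::real_inner \<Rightarrow> ereal) \<Rightarrow> 'a \<Rightarrow> 'a set" where
  "frechet_subdiff \<psi> x =
     {v. x \<in> edom \<psi> \<and>
         0 \<le> Liminf (at x) (\<lambda>y. (\<psi> y - \<psi> x - ereal (v \<bullet> (y - x))) / ereal (norm (y - x)))}"

definition limiting_subdiff :: "('a::real_inner \<Rightarrow> ereal) \<Rightarrow> 'a \<Rightarrow> 'a set" where
  "limiting_subdiff \<psi> x =
     {v. x \<in> edom \<psi> \<and>
         (\<exists>xs vs. xs \<longlonglongrightarrow> x \<and> (\<lambda>n. \<psi> (xs n)) \<longlonglongrightarrow> \<psi> x \<and>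
                  (\<forall>n. vs n \<in> frechet_subdiff \<psi> (xs n)) \<and> vs \<longlonglongrightarrow> v)}"

definition frechet_stationary :: "('a::real_inner \<Rightarrow> ereal) \<Rightarrow> ('a \<Rightarrow> ereal) \<Rightarrow> 'a \<Rightarrow> bool" where
  "frechet_stationary F \<phi> x \<longleftrightarrow> x \<in> edom \<phi> \<and> 0 \<in> frechet_subdiff (\<lambda>y. F y + \<phi> y) x"

definition lower_regular_at :: "('a::real_inner \<Rightarrow> ereal) \<Rightarrow> 'a \<Rightarrow> bool" where
  "lower_regular_at \<psi> x \<longleftrightarrow> x \<in> edom \<psi> \<and> frechet_subdiff \<psi> x = limiting_subdiff \<psi> x"

definition prox_regular_at_for :: "('a::real_inner \<Rightarrow> ereal) \<Rightarrow> 'a \<Rightarrow> 'a \<Rightarrow> bool" where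
  "prox_regular_at_for \<psi> xb vb \<longleftrightarrow>
     (\<exists>\<delta>>0. \<exists>\<eta>\<ge>0. \<forall>x v x'.
        x \<in> ball xb \<delta> \<and> v \<in> limiting_subdiff \<psi> x \<inter> ball vb \<delta> \<and> \<psi> x < \<psi> xb + ereal \<delta> \<and>
        x' \<in> ball xb \<delta> \<longrightarrow>
        \<psi> x' \<ge> \<psi> x + ereal (v \<bullet> (x' - x)) - ereal (\<eta> / 2 * (norm (x' - x))\<^sup>2))"

definition prox_regular_at :: "('a::real_inner \<Rightarrow> ereal) \<Rightarrow> 'a \<Rightarrow> bool" where
  "prox_regular_at \<psi> xb \<longleftrightarrow>
     xb \<in> edom \<psi> \<and> (\<forall>vb\<in>limiting_subdiff \<psi> xb. prox_regular_at_for \<psi> xb vb)"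

text \<open>The infinite index set along which the limit is taken is the range of \<open>r\<close>.\<close>

definition set_Limsup :: "(nat \<Rightarrow> 'a::topological_space set) \<Rightarrow> 'a set" where
  "set_Limsup E = {v. \<exists>r vs. strict_mono r \<and> (\<forall>k. vs k \<in> E (r k)) \<and> vs \<longlonglongrightarrow> v}"

definition outer_semicontinuous_at :: "('a::topological_space \<Rightarrow> 'a set) \<Rightarrow> 'a \<Rightarrow> bool" where
  "outer_semicontinuous_at S x \<longleftrightarrow> (\<forall>xs. xs \<longlonglongrightarrow> x \<longrightarrow> set_Limsup (\<lambda>n. S (xs n)) \<subseteq> S x)"

definition cluster_point_of_seq :: "(nat \<Rightarrow> 'a::topological_space) \<Rightarrow> 'a \<Rightarrow> bool" where
  "cluster_point_of_seq xs x \<longleftrightarrow> (\<exists>r. strict_mono r \<and> (\<lambda>k. xs (r k)) \<longlonglongrightarrow> x)"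

text \<open>Only meaningful at interior points of the effective domain where the function is
  differentiable.\<close>

definition gradient :: "('a::real_inner \<Rightarrow> ereal) \<Rightarrow> 'a \<Rightarrow> 'a" where
  "gradient g x = (THE D. GDERIV (\<lambda>y. real_of_ereal (g y)) x :> D)"

text \<open>
  \<open>Fs \<mu>\<close> is the smoothed function with parameter \<open>\<mu>\<close>, where \<open>\<mu>\<close> ranges over the reals strictly
  between \<open>0\<close> and \<open>mt\<close>; the values of \<open>Fs\<close> at other parameters are irrelevant.
\<close>

definition smoothing_function ::
  "('a::euclidean_space \<Rightarrow> ereal) \<Rightarrow> ereal \<Rightarrow> (real \<Rightarrow> 'a \<Rightarrow> ereal) \<Rightarrow> real \<Rightarrow> real \<Rightarrow> real \<Rightarrow> bool"
where
  "smoothing_function F mt Fs \<kappa> w1 w2 \<longleftrightarrow>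
     (let D = interior (edom F); P = {\<mu>::real. 0 < \<mu> \<and> ereal \<mu> < mt} in
       0 < mt \<and> 0 < \<kappa> \<and> 0 \<le> w1 \<and> 0 < w2 \<and>
       (\<forall>\<mu>\<in>P. (\<forall>x. Fs \<mu> x \<noteq> -\<infinity>) \<and> interior (edom (Fs \<mu>)) = D) \<and>
       (\<forall>x\<in>D. ((\<lambda>\<mu>. Fs \<mu> x) \<longlongrightarrow> F x) (at_right 0)) \<and>
       (\<forall>\<mu>\<in>P. \<forall>\<mu>'\<in>P. \<mu>' \<le> \<mu> \<longrightarrow>
          (\<forall>x\<in>D. 0 \<le> Fs \<mu>' x - Fs \<mu> x \<and> Fs \<mu>' x - Fs \<mu> x \<le> ereal (\<kappa> * (\<mu> - \<mu>')))) \<and>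
       (\<forall>\<mu>\<in>P. (\<forall>x\<in>D. \<exists>d. GDERIV (\<lambda>y. real_of_ereal (Fs \<mu> y)) x :> d) \<and>
               continuous_on D (gradient (Fs \<mu>)) \<and>
               (w1 + w2 * inverse \<mu>)-lipschitz_on D (gradient (Fs \<mu>))) \<and>
       (\<forall>x\<in>D. limiting_subdiff F x =
          {v. \<exists>xs ms. (\<forall>n. xs n \<in> D) \<and> (\<forall>n. ms n \<in> P) \<and> xs \<longlonglongrightarrow> x \<and>
                decseq ms \<and> ms \<longlonglongrightarrow> 0 \<and> (\<lambda>n. gradient (Fs (ms n)) (xs n)) \<longlonglongrightarrow> v}))"

definition prox :: "real \<Rightarrow> ('a::real_normed_vector \<Rightarrow> ereal) \<Rightarrow> 'a \<Rightarrow> 'a set" where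
  "prox \<gamma> \<phi> xb =
     {p. is_arg_min (\<lambda>x. \<phi> x + ereal (1 / (2 * \<gamma>) * (norm (x - xb))\<^sup>2)) (\<lambda>_. True) p}"

definition stationarity_measure ::
  "real \<Rightarrow> ('a::real_inner \<Rightarrow> ereal) \<Rightarrow> ('a \<Rightarrow> ereal) \<Rightarrow> 'a \<Rightarrow> ereal" where
  "stationarity_measure \<gamma> G \<phi> xb =
     Inf {ereal (norm ((xb - p) /\<^sub>R \<gamma>)) |p v.
            v \<in> limiting_subdiff G xb \<and> p \<in> prox \<gamma> \<phi> (xb - \<gamma> *\<^sub>R v)}"

text \<open>
  One run of the backtracking loop at the point \<open>xn\<close> for the smoothed function \<open>G\<close> and the
  reference value \<open>r\<close>: \<open>p j\<close> is the point picked for trial step size \<open>\<rho>\<^sup>j ginit\<close>, and \<open>l\<close> is the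
  first index at which the acceptance test succeeds.  The outcome is the new iterate \<open>x'\<close> together
  with the accepted step size \<open>\<gamma>\<close>.
\<close>

definition backtracking_loop ::
  "('a::real_inner \<Rightarrow> ereal) \<Rightarrow> ('a \<Rightarrow> ereal) \<Rightarrow> real \<Rightarrow> real \<Rightarrow> real \<Rightarrow> real \<Rightarrow> 'a \<Rightarrow> 'a \<Rightarrow> real \<Rightarrow> bool"
where
  "backtracking_loop G \<phi> c \<rho> ginit r xn x' \<gamma> \<longleftrightarrow>
     (let step = (\<lambda>j::nat. \<rho> ^ j * ginit);
          accept = (\<lambda>j p. G p + \<phi> p \<le>
                      ereal (r - c * step j * (norm ((xn - p) /\<^sub>R step j))\<^sup>2))
      in \<exists>l p. (\<forall>j\<le>l. p j \<in> prox (step j) \<phi> (xn - step j *\<^sub>R gradient G xn)) \<and>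
               (\<forall>j<l. \<not> accept j (p j)) \<and> accept l (p l) \<and>
               x' = p l \<and> \<gamma> = step l)"

text \<open>
  Sequences are indexed from \<open>1\<close>; their entries at \<open>0\<close> are irrelevant.  The reference values are
  real because every iterate lies in \<open>edom \<phi>\<close>, hence in the interior of the effective domain of
  every smoothed function.
\<close>

definition prox_variable_smoothing_run ::
  "('a::real_inner \<Rightarrow> ereal) \<Rightarrow> (real \<Rightarrow> 'a \<Rightarrow> ereal) \<Rightarrow> real \<Rightarrow> real \<Rightarrow> real \<Rightarrow> real \<Rightarrow> real \<Rightarrow>
   (nat \<Rightarrow> real) \<Rightarrow> (nat \<Rightarrow> 'a) \<Rightarrow> (nat \<Rightarrow> real) \<Rightarrow> (nat \<Rightarrow> real) \<Rightarrow> bool"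
where
  "prox_variable_smoothing_run \<phi> Fs \<kappa> c \<rho> ginit \<theta> \<mu> x \<gamma> R \<longleftrightarrow>
     x 1 \<in> edom \<phi> \<and>
     ereal (R 1) = Fs (\<mu> 1) (x 1) + \<phi> (x 1) \<and>
     (\<exists>\<theta>s::nat \<Rightarrow> real. \<forall>n>1. \<theta> \<le> \<theta>s n \<and> \<theta>s n \<le> 1 \<and>
        ereal (R n) = ereal (\<theta>s n) * (Fs (\<mu> n) (x n) + \<phi> (x n))
          + ereal ((1 - \<theta>s n) * (R (n - 1) + \<kappa> * (\<mu> (n - 1) - \<mu> n)))) \<and>
     (\<forall>n\<ge>1. backtracking_loop (Fs (\<mu> n)) \<phi> c \<rho> ginit (R n) (x n) (x (n + 1)) (\<gamma> n))"

end

theory Submission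
  imports Defs
begin

text \<open>
  The acceptance test and the monotonicity of the smoothing in its parameter make
  \<open>R\<^sub>n + \<kappa> \<mu>\<^sub>n\<close> decrease by at least a multiple of \<open>\<gamma>\<^sub>n\<close> times the squared residual. By the
  descent lemma the backtracking accepts every step of length at most \<open>(1 - 2c) / (w1 + w2/\<mu>\<^sub>n)\<close>,
  so \<open>\<gamma>\<^sub>n\<close> is bounded below by a multiple of \<open>\<mu>\<^sub>n\<close>, and telescoping gives the bound \<open>\<chi>\<close>; the
  divergence of \<open>\<Sum> \<mu>\<^sub>n\<close> then drives the stationarity measure to \<open>0\<close> along a subsequence. At a
  cluster point, the gradients of the smoothed functions are bounded because \<open>F\<close> is locally
  Lipschitz, and the optimality condition of the proximal step passes to the limit.
\<close>

section \<open>Subgradients\<close>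

text \<open>Off \<open>x\<close> the factor \<open>norm (y - x)\<close> is positive, so the quotient
  can be multiplied out, also where \<open>\<psi> y\<close> is infinite. The resulting epsilon
  inequality has a real left-hand side, so such bounds can be added and compared directly.\<close>

lemma frechet_subdiff_iff:
  fixes \<psi> :: "'a::real_inner \<Rightarrow> ereal"
  assumes r: "\<psi> x = ereal r"
  shows "v \<in> frechet_subdiff \<psi> x \<longleftrightarrow>
    (\<forall>e>0. \<forall>\<^sub>F y in at x. ereal (r + v \<bullet> (y - x) - e * norm (y - x)) \<le> \<psi> y)"
proof -
  let ?q = "\<lambda>y. (\<psi> y - \<psi> x - ereal (v \<bullet> (y - x))) / ereal (norm (y - x))"
  have q: "ereal (- e) \<le> ?q y \<longleftrightarrow> ereal (r + v \<bullet> (y - x) - e * norm (y - x)) \<le> \<psi> y"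
    if "y \<noteq> x" for e y
  proof -
    have n: "norm (y - x) > 0" using that by simp
    show ?thesis
      using n by (cases "\<psi> y") (auto simp: r field_simps)
  qed
  have "v \<in> frechet_subdiff \<psi> x \<longleftrightarrow> 0 \<le> Liminf (at x) ?q"
    by (simp add: frechet_subdiff_def edom_def r)
  also have "\<dots> \<longleftrightarrow> (\<forall>e>0. \<forall>\<^sub>F y in at x. ereal (- e) \<le> ?q y)"
  proof
    assume L: "0 \<le> Liminf (at x) ?q"
    show "\<forall>e>0. \<forall>\<^sub>F y in at x. ereal (- e) \<le> ?q y"
    proof (intro allI impI)
      fix e :: real assume "e > 0"
      then have "ereal (- e) < 0" by (simp flip: zero_ereal_def)
      with L have "\<forall>\<^sub>F y in at x. ereal (- e) < ?q y"
        unfolding le_Liminf_iff by blast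
      then show "\<forall>\<^sub>F y in at x. ereal (- e) \<le> ?q y"
        by (rule eventually_mono) simp
    qed
  next
    assume R: "\<forall>e>0. \<forall>\<^sub>F y in at x. ereal (- e) \<le> ?q y"
    show "0 \<le> Liminf (at x) ?q"
      unfolding le_Liminf_iff
    proof (intro allI impI)
      fix b :: ereal assume "b < 0"
      \<comment> \<open>Since \<open>b\<close> may be minus infinity, a real level between
        \<open>b\<close> and 0 is inserted first.\<close>
      then obtain e where e: "b < ereal e" "e < 0"
        using ereal_dense2[of b 0] by (auto simp: zero_ereal_def)
      have "\<forall>\<^sub>F y in at x. ereal (- (- e)) \<le> ?q y"
        using R[rule_format, of "- e"] e by simp
      then show "\<forall>\<^sub>F y in at x. b < ?q y"
        by (rule eventually_mono) (use e in \<open>auto intro: less_le_trans\<close>)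
    qed
  qed
  also have "\<dots> \<longleftrightarrow> (\<forall>e>0. \<forall>\<^sub>F y in at x. ereal (r + v \<bullet> (y - x) - e * norm (y - x)) \<le> \<psi> y)"
    by (intro all_cong imp_cong refl eventually_cong[OF eventually_neq_at_within]) (rule q)
  finally show ?thesis .
qed

text \<open>A quadratic error is of smaller order than \<open>norm (y - x)\<close>. This serves both
  the support inequality of a proximal point and the one supplied by prox-regularity.\<close>

lemma frechet_subdiff_quadraticI:
  fixes \<psi> :: "'a::real_inner \<Rightarrow> ereal"
  assumes r: "\<psi> x = ereal r" and d: "d > 0"
    and ge: "\<And>y. dist y x < d \<Longrightarrow> ereal (r + v \<bullet> (y - x) - K * (norm (y - x))\<^sup>2) \<le> \<psi> y"
  shows "v \<in> frechet_subdiff \<psi> x"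
  unfolding frechet_subdiff_iff[of \<psi>, OF r]
proof (intro allI impI)
  fix e :: real assume e: "e > 0"
  \<comment> \<open>Within this radius \<open>K * norm (y - x)\<close> is at most \<open>e\<close>;
    the \<open>+ 1\<close> keeps the quotient meaningful for \<open>K = 0\<close>.\<close>
  have "\<forall>\<^sub>F y in at x. dist y x < min d (e / (\<bar>K\<bar> + 1))"
    unfolding eventually_at using d e by (intro exI[of _ "min d (e / (\<bar>K\<bar> + 1))"]) auto
  then show "\<forall>\<^sub>F y in at x. ereal (r + v \<bullet> (y - x) - e * norm (y - x)) \<le> \<psi> y"
  proof (rule eventually_mono)
    fix y assume y: "dist y x < min d (e / (\<bar>K\<bar> + 1))"
    let ?n = "norm (y - x)"
    have "?n * (\<bar>K\<bar> + 1) < e" using y by (simp add: dist_norm field_simps)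
    then have "K * ?n \<le> e" by (smt (verit) mult_right_mono norm_ge_zero mult.commute distrib_left)
    then have "K * ?n\<^sup>2 \<le> e * ?n"
      using mult_right_mono[of "K * ?n" e ?n] by (simp add: power2_eq_square mult.assoc)
    then have "ereal (r + v \<bullet> (y - x) - e * ?n) \<le> ereal (r + v \<bullet> (y - x) - K * ?n\<^sup>2)"
      by simp
    also have "\<dots> \<le> \<psi> y" using ge y by simp
    finally show "ereal (r + v \<bullet> (y - x) - e * ?n) \<le> \<psi> y" .
  qed
qed

text \<open>Each summand gets half of the error \<open>e\<close>. The analogous inclusion fails in
  general for limiting subdifferentials, which is why the limiting subgradients found at a cluster
  point are first turned into Frechet ones.\<close>

lemma frechet_subdiff_add:
  fixes \<psi> \<xi> :: "'a::real_inner \<Rightarrow> ereal"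
  assumes r: "\<psi> x = ereal r" "\<xi> x = ereal s"
    and v: "v \<in> frechet_subdiff \<psi> x" and w: "w \<in> frechet_subdiff \<xi> x"
  shows "v + w \<in> frechet_subdiff (\<lambda>y. \<psi> y + \<xi> y) x"
proof -
  have rs: "\<psi> x + \<xi> x = ereal (r + s)" using r by simp
  show ?thesis
    unfolding frechet_subdiff_iff[of "\<lambda>y. \<psi> y + \<xi> y", OF rs]
  proof (intro allI impI)
    fix e :: real assume "e > 0"
    then have "\<forall>\<^sub>F y in at x. ereal (r + v \<bullet> (y - x) - (e/2) * norm (y - x)) \<le> \<psi> y"
      "\<forall>\<^sub>F y in at x. ereal (s + w \<bullet> (y - x) - (e/2) * norm (y - x)) \<le> \<xi> y"
      using v[unfolded frechet_subdiff_iff[of \<psi>, OF r(1)], rule_format, of "e/2"]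
        w[unfolded frechet_subdiff_iff[of \<xi>, OF r(2)], rule_format, of "e/2"] by auto
    then show "\<forall>\<^sub>F y in at x. ereal (r + s + (v + w) \<bullet> (y - x) - e * norm (y - x)) \<le> \<psi> y + \<xi> y"
    proof eventually_elim
      case (elim y)
      have "ereal (r + s + (v + w) \<bullet> (y - x) - e * norm (y - x)) =
        ereal (r + v \<bullet> (y - x) - (e/2) * norm (y - x)) + ereal (s + w \<bullet> (y - x) - (e/2) * norm (y - x))"
        by (simp add: algebra_simps)
      also have "\<dots> \<le> \<psi> y + \<xi> y" using elim by (rule add_mono)
      finally show ?case .
    qed
  qed
qed

lemma frechet_subset_limiting: "frechet_subdiff \<psi> x \<subseteq> limiting_subdiff \<psi> x"
proof
  fix v assume v: "v \<in> frechet_subdiff \<psi> x"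
  then have "x \<in> edom \<psi>" by (simp add: frechet_subdiff_def)
  with v show "v \<in> limiting_subdiff \<psi> x"
    unfolding limiting_subdiff_def mem_Collect_eq
    by (intro conjI exI[of _ "\<lambda>_. x"] exI[of _ "\<lambda>_. v"]) auto
qed

lemma GDERIV_unique: "GDERIV f x :> d \<Longrightarrow> GDERIV f x :> d' \<Longrightarrow> d = d'"
  unfolding gderiv_def
  by (metis has_derivative_unique inner_commute vector_eq_rdot)

lemma gradient_eqI: "GDERIV (\<lambda>y. real_of_ereal (\<psi> y)) x :> d \<Longrightarrow> gradient \<psi> x = d"
  unfolding gradient_def using GDERIV_unique by blast

lemma gderiv_eventually:
  fixes f :: "'a::real_inner \<Rightarrow> real"
  assumes "GDERIV f x :> d" "e > 0"
  shows "\<forall>\<^sub>F y in nhds x. \<bar>f y - f x - d \<bullet> (y - x)\<bar> \<le> e * norm (y - x)"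
proof -
  obtain \<delta> where \<delta>: "\<delta> > 0"
    "\<And>y. norm (y - x) < \<delta> \<Longrightarrow> norm (f y - f x - (y - x) \<bullet> d) \<le> e * norm (y - x)"
    using assms unfolding gderiv_def has_derivative_at_alt by meson
  show ?thesis
    unfolding eventually_nhds_metric
    using \<delta> by (auto intro!: exI[of _ \<delta>] simp: dist_norm inner_commute)
qed

lemma frechet_subdiff_smooth:
  fixes \<psi> :: "'a::euclidean_space \<Rightarrow> ereal"
  assumes ninf: "\<And>y. \<psi> y \<noteq> -\<infinity>" and x: "x \<in> interior (edom \<psi>)"
    and d: "GDERIV (\<lambda>y. real_of_ereal (\<psi> y)) x :> d"
  shows "frechet_subdiff \<psi> x = {d}"
proof -
  let ?f = "\<lambda>y. real_of_ereal (\<psi> y)"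
  have ev: "\<forall>\<^sub>F y in nhds x. \<psi> y = ereal (?f y)"
  proof -
    have "\<forall>\<^sub>F y in nhds x. y \<in> interior (edom \<psi>)"
      using x by (intro eventually_nhds_in_open) auto
    then show ?thesis
    proof (rule eventually_mono)
      fix y assume "y \<in> interior (edom \<psi>)"
      then have "\<psi> y < \<infinity>" using interior_subset by (auto simp: edom_def)
      then show "\<psi> y = ereal (?f y)" using ninf[of y] by (cases "\<psi> y") auto
    qed
  qed
  then have r: "\<psi> x = ereal (?f x)" by (rule eventually_nhds_x_imp_x)
  have "d \<in> frechet_subdiff \<psi> x"
    unfolding frechet_subdiff_iff[of \<psi>, OF r]
  proof (intro allI impI)
    fix e :: real assume e: "e > 0"
    have "\<forall>\<^sub>F y in nhds x. ereal (?f x + d \<bullet> (y - x) - e * norm (y - x)) \<le> \<psi> y"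
      using gderiv_eventually[OF d e] ev
    proof eventually_elim
      case (elim y)
      have "ereal (?f x + d \<bullet> (y - x) - e * norm (y - x)) \<le> ereal (?f y)"
        using elim(1) by (simp add: abs_le_iff)
      then show ?case using elim(2) by simp
    qed
    then show "\<forall>\<^sub>F y in at x. ereal (?f x + d \<bullet> (y - x) - e * norm (y - x)) \<le> \<psi> y"
      unfolding eventually_at_filter by (rule eventually_mono) auto
  qed
  moreover have "v = d" if v: "v \<in> frechet_subdiff \<psi> x" for v
  proof (rule ccontr)
    assume "v \<noteq> d"
    \<comment> \<open>Along the ray from \<open>x\<close> in direction \<open>u\<close>, the linear
      models with slopes \<open>v\<close> and \<open>d\<close> drift apart by
      \<open>t * (u \<bullet> u)\<close>, while the derivative and the subgradient inequality
      together allow only \<open>2 * e * t * norm u\<close>. With \<open>e = norm u / 4\<close> that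
      is half of the drift, a contradiction.\<close>
    define u where "u = v - d"
    have u: "norm u > 0" using \<open>v \<noteq> d\<close> by (simp add: u_def)
    define e where "e = norm u / 4"
    have e: "e > 0" using u by (simp add: e_def)
    have "\<forall>\<^sub>F y in at x. ereal (?f x + v \<bullet> (y - x) - e * norm (y - x)) \<le> \<psi> y"
      using v e frechet_subdiff_iff[of \<psi>, OF r] by blast
    then have "\<forall>\<^sub>F y in nhds x. y \<noteq> x \<longrightarrow> ereal (?f x + v \<bullet> (y - x) - e * norm (y - x)) \<le> \<psi> y"
      unfolding eventually_at_filter by simp
    with gderiv_eventually[OF d e] ev
    have "\<forall>\<^sub>F y in nhds x. y \<noteq> x \<longrightarrow> u \<bullet> (y - x) \<le> 2 * e * norm (y - x)"
    proof eventually_elim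
      case (elim y)
      show ?case
      proof
        assume "y \<noteq> x"
        then have "ereal (?f x + v \<bullet> (y - x) - e * norm (y - x)) \<le> ereal (?f y)"
          using elim(2,3) by simp
        then show "u \<bullet> (y - x) \<le> 2 * e * norm (y - x)"
          using elim(1) by (simp add: u_def inner_diff_left abs_le_iff)
      qed
    qed
    moreover have "((\<lambda>t::real. x + t *\<^sub>R u) \<longlongrightarrow> x + 0 *\<^sub>R u) (at_right 0)"
      by (intro tendsto_intros)
    then have "filterlim (\<lambda>t::real. x + t *\<^sub>R u) (nhds x) (at_right 0)" by simp
    ultimately have "\<forall>\<^sub>F t in at_right 0. x + t *\<^sub>R u \<noteq> x \<longrightarrow>
        u \<bullet> (x + t *\<^sub>R u - x) \<le> 2 * e * norm (x + t *\<^sub>R u - x)"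
      by (rule eventually_compose_filterlim)
    then have "\<forall>\<^sub>F t::real in at_right 0. False"
      using eventually_at_right_less[of 0]
    proof eventually_elim
      case (elim t)
      then have "t * (u \<bullet> u) \<le> 2 * e * (t * norm u)" using u by auto
      then have "t * (norm u * norm u) \<le> t * ((norm u / 2) * norm u)"
        by (simp add: e_def dot_square_norm power2_eq_square mult_ac)
      then have "norm u * norm u \<le> (norm u / 2) * norm u" using elim by simp
      then show False using mult_pos_pos[OF u u] by linarith
    qed
    then show False by simp
  qed
  ultimately show ?thesis by blast
qed

text \<open>Near \<open>x\<close> every Frechet subdifferential is the singleton of the gradient,
  and continuity carries this to the limit. Hence for a smoothed function the only \<open>v\<close>
  that enters \<open>stationarity_measure\<close> is the gradient used by the algorithm.\<close>

lemma limiting_subdiff_smooth: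
  fixes \<psi> :: "'a::euclidean_space \<Rightarrow> ereal"
  assumes ninf: "\<And>y. \<psi> y \<noteq> -\<infinity>"
    and d: "\<And>y. y \<in> interior (edom \<psi>) \<Longrightarrow> \<exists>d. GDERIV (\<lambda>y. real_of_ereal (\<psi> y)) y :> d"
    and cont: "continuous_on (interior (edom \<psi>)) (gradient \<psi>)"
    and x: "x \<in> interior (edom \<psi>)"
  shows "limiting_subdiff \<psi> x = {gradient \<psi> x}"
proof -
  have fr: "frechet_subdiff \<psi> y = {gradient \<psi> y}" if "y \<in> interior (edom \<psi>)" for y
    using frechet_subdiff_smooth[OF ninf that] d[OF that] gradient_eqI by metis
  have "v = gradient \<psi> x" if "v \<in> limiting_subdiff \<psi> x" for v
  proof -
    from that obtain xs vs where xs: "xs \<longlonglongrightarrow> x" and vs: "vs \<longlonglongrightarrow> v"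
      and m: "\<And>n. vs n \<in> frechet_subdiff \<psi> (xs n)"
      unfolding limiting_subdiff_def by auto
    have "\<forall>\<^sub>F n in sequentially. xs n \<in> interior (edom \<psi>)"
      using xs x by (simp add: topological_tendstoD)
    then have "\<forall>\<^sub>F n in sequentially. gradient \<psi> (xs n) = vs n"
    proof (rule eventually_mono)
      show "gradient \<psi> (xs n) = vs n" if "xs n \<in> interior (edom \<psi>)" for n
        using fr[OF that] m[of n] by simp
    qed
    moreover have "(\<lambda>n. gradient \<psi> (xs n)) \<longlonglongrightarrow> gradient \<psi> x"
      using cont x xs by (metis continuous_on_eq_continuous_at isCont_tendsto_compose open_interior)
    ultimately have "vs \<longlonglongrightarrow> gradient \<psi> x"
      by (rule Lim_transform_eventually[rotated])
    then show ?thesis using vs LIMSEQ_unique by blast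
  qed
  then show ?thesis using fr[OF x] frechet_subset_limiting[of \<psi> x] by blast
qed

lemma lsc_fun_eventually:
  assumes "lsc_fun \<psi>" "b < \<psi> x"
  shows "\<forall>\<^sub>F y in nhds x. b < \<psi> y"
proof -
  have "\<forall>\<^sub>F y in at x. b < \<psi> y"
    using assms unfolding lsc_fun_def le_Liminf_iff by blast
  then show ?thesis using assms(2) by (auto simp: eventually_at_filter elim: eventually_mono)
qed

section \<open>The descent lemma and the proximal inequality\<close>

text \<open>Subtract the quadratic model from \<open>f\<close> along the segment, which convexity
  keeps inside \<open>D\<close>. The difference \<open>h\<close> is nonincreasing: by Cauchy-Schwarz
  and the Lipschitz bound, the slope of \<open>f\<close> along the segment grows by at most
  \<open>L * t * (norm w)^2\<close>.\<close>

lemma descent_lemma: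
  fixes f :: "'a::real_inner \<Rightarrow> real"
  assumes D: "convex D" "x \<in> D" "y \<in> D"
    and der: "\<And>z. z \<in> D \<Longrightarrow> GDERIV f z :> g z"
    and lip: "L-lipschitz_on D g"
  shows "f y \<le> f x + g x \<bullet> (y - x) + L / 2 * (norm (y - x))\<^sup>2"
proof -
  define w where "w = y - x"
  define h where "h t = f (x + t *\<^sub>R w) - t * (g x \<bullet> w) - L / 2 * t\<^sup>2 * (norm w)\<^sup>2" for t
  have mem: "x + t *\<^sub>R w \<in> D" if "0 \<le> t" "t \<le> 1" for t
  proof -
    have "(1 - t) *\<^sub>R x + t *\<^sub>R y \<in> D" using D that by (intro convexD) auto
    then show ?thesis by (simp add: w_def algebra_simps)
  qed
  have "h 1 \<le> h 0"
  proof (rule DERIV_nonpos_imp_nonincreasing[of 0 1 h])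
    fix t :: real assume t: "0 \<le> t" "t \<le> 1"
    let ?z = "x + t *\<^sub>R w"
    have fd: "(f has_derivative (\<lambda>k. k \<bullet> g ?z)) (at ?z)"
      using der[OF mem[OF t]] by (simp add: gderiv_def)
    have "((\<lambda>t. x + t *\<^sub>R w) has_derivative (\<lambda>s. s *\<^sub>R w)) (at t)"
      by (auto intro!: derivative_eq_intros)
    then have "((\<lambda>t. f (x + t *\<^sub>R w)) has_derivative (\<lambda>s. (s *\<^sub>R w) \<bullet> g ?z)) (at t)"
      using fd by (rule has_derivative_compose)
    then have "((\<lambda>t. f (x + t *\<^sub>R w)) has_real_derivative (w \<bullet> g ?z)) (at t)"
      by (simp add: has_field_derivative_def mult.commute[of _ "w \<bullet> g ?z"])
    then have "(h has_real_derivative (w \<bullet> g ?z - g x \<bullet> w - L * t * (norm w)\<^sup>2)) (at t)"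
      unfolding h_def by (auto intro!: derivative_eq_intros)
    moreover have "w \<bullet> g ?z - g x \<bullet> w - L * t * (norm w)\<^sup>2 \<le> 0"
    proof -
      have "w \<bullet> g ?z - g x \<bullet> w = w \<bullet> (g ?z - g x)"
        by (simp add: inner_diff_right inner_commute)
      also have "\<dots> \<le> norm w * norm (g ?z - g x)"
        by (rule norm_cauchy_schwarz)
      also have "\<dots> \<le> norm w * (L * (t * norm w))"
      proof (rule mult_left_mono)
        have "dist (g ?z) (g x) \<le> L * dist ?z x"
          using lip mem[OF t] D(2) by (rule lipschitz_onD)
        then show "norm (g ?z - g x) \<le> L * (t * norm w)" using t by (simp add: dist_norm)
      qed simp
      finally show ?thesis by (simp add: power2_eq_square mult_ac)
    qed
    ultimately show "\<exists>y. (h has_real_derivative y) (at t) \<and> y \<le> 0" by blast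
  qed simp
  then show ?thesis by (simp add: h_def w_def)
qed

lemma descent_lemma_lower:
  fixes f :: "'a::real_inner \<Rightarrow> real"
  assumes D: "convex D" "x \<in> D" "y \<in> D"
    and der: "\<And>z. z \<in> D \<Longrightarrow> GDERIV f z :> g z"
    and lip: "L-lipschitz_on D g"
  shows "f x + g x \<bullet> (y - x) - L / 2 * (norm (y - x))\<^sup>2 \<le> f y"
proof -
  have "- f y \<le> - f x + (- g x) \<bullet> (y - x) + L / 2 * (norm (y - x))\<^sup>2"
  proof (rule descent_lemma[OF D])
    show "GDERIV (\<lambda>z. - f z) z :> - g z" if "z \<in> D" for z
      using der[OF that] by (rule GDERIV_minus)
    show "L-lipschitz_on D (\<lambda>z. - g z)" using lip by simp
  qed
  then show ?thesis by simp
qed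

lemma prox_in_edom:
  assumes "proper_fun \<phi>" "p \<in> prox \<gamma> \<phi> z"
  shows "p \<in> edom \<phi>"
proof -
  obtain y where "\<phi> y < \<infinity>" using assms(1) unfolding proper_fun_def edom_def by auto
  moreover have "\<not> \<phi> y + ereal (1 / (2 * \<gamma>) * (norm (y - z))\<^sup>2) < \<phi> p + ereal (1 / (2 * \<gamma>) * (norm (p - z))\<^sup>2)"
    using assms(2) unfolding prox_def is_arg_min_def by blast
  ultimately show ?thesis by (cases "\<phi> p") (auto simp: edom_def)
qed

text \<open>Expanding the squared distance to \<open>z\<close> around \<open>p\<close> turns global
  minimality into a quadratic support of \<open>\<phi>\<close> at \<open>p\<close> with slope
  \<open>(z - p) /\<gamma>\<close>. Evaluated at the current iterate it yields the decrease of a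
  trial step; read as a bound in all \<open>y\<close> it makes the slope a Frechet
  subgradient.\<close>

lemma prox_ineq:
  fixes \<phi> :: "'a::real_inner \<Rightarrow> ereal"
  assumes \<phi>: "proper_fun \<phi>" and \<gamma>: "0 < \<gamma>" and p: "p \<in> prox \<gamma> \<phi> z" "\<phi> p = ereal r"
  shows "ereal (r + ((z - p) /\<^sub>R \<gamma>) \<bullet> (y - p) - 1 / (2 * \<gamma>) * (norm (y - p))\<^sup>2) \<le> \<phi> y"
proof -
  have le: "\<phi> p + ereal (1 / (2 * \<gamma>) * (norm (p - z))\<^sup>2) \<le> \<phi> y + ereal (1 / (2 * \<gamma>) * (norm (y - z))\<^sup>2)"
    using p(1) unfolding prox_def is_arg_min_def by (auto simp: not_less)
  have "(norm (y - z))\<^sup>2 = (norm (y - p))\<^sup>2 + 2 * ((y - p) \<bullet> (p - z)) + (norm (p - z))\<^sup>2"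
    unfolding power2_norm_eq_inner
    by (simp add: inner_diff_left inner_diff_right inner_commute algebra_simps)
  moreover have "((z - p) /\<^sub>R \<gamma>) \<bullet> (y - p) = - ((y - p) \<bullet> (p - z)) / \<gamma>"
    by (simp add: inner_diff_left inner_diff_right inner_commute divide_inverse algebra_simps)
  ultimately have "((z - p) /\<^sub>R \<gamma>) \<bullet> (y - p) - 1 / (2 * \<gamma>) * (norm (y - p))\<^sup>2 =
      1 / (2 * \<gamma>) * (norm (p - z))\<^sup>2 - 1 / (2 * \<gamma>) * (norm (y - z))\<^sup>2"
    using \<gamma> by (simp add: field_simps)
  with le p(2) show ?thesis
    by (cases "\<phi> y") auto
qed

section \<open>Smoothing functions\<close>

locale smoothing =
  fixes F :: "'a::euclidean_space \<Rightarrow> ereal" and mt :: ereal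
    and Fs :: "real \<Rightarrow> 'a \<Rightarrow> ereal" and \<kappa> w1 w2 :: real
  assumes smoothing: "smoothing_function F mt Fs \<kappa> w1 w2"
    and F_ninf: "\<And>y. F y \<noteq> -\<infinity>" and convex_edom_F: "convex (edom F)"
begin

abbreviation D :: "'a set" where "D \<equiv> interior (edom F)"
abbreviation admissible :: "real \<Rightarrow> bool" where "admissible \<mu> \<equiv> 0 < \<mu> \<and> ereal \<mu> < mt"
abbreviation lipc :: "real \<Rightarrow> real" where "lipc \<mu> \<equiv> w1 + w2 * inverse \<mu>"
abbreviation fr :: "'a \<Rightarrow> real" where "fr y \<equiv> real_of_ereal (F y)"
abbreviation fs :: "real \<Rightarrow> 'a \<Rightarrow> real" where "fs \<mu> y \<equiv> real_of_ereal (Fs \<mu> y)"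

lemma constants: "0 < mt" "0 < \<kappa>" "0 \<le> w1" "0 < w2"
  using smoothing by (auto simp: smoothing_function_def Let_def)

lemma lipc_pos: "0 < \<mu> \<Longrightarrow> 0 < lipc \<mu>"
  using constants by (simp add: add_nonneg_pos)

lemma convex_D: "convex D"
  using convex_edom_F by (rule convex_interior)

lemma Fs_ninf: "admissible \<mu> \<Longrightarrow> Fs \<mu> y \<noteq> -\<infinity>"
  and interior_edom_Fs: "admissible \<mu> \<Longrightarrow> interior (edom (Fs \<mu>)) = D"
  using smoothing by (simp_all add: smoothing_function_def Let_def)

lemma F_real: "y \<in> D \<Longrightarrow> F y = ereal (fr y)"
  using interior_subset[of "edom F"] F_ninf[of y] by (cases "F y") (auto simp: edom_def)

lemma Fs_real: "admissible \<mu> \<Longrightarrow> y \<in> D \<Longrightarrow> Fs \<mu> y = ereal (fs \<mu> y)"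
  using interior_subset[of "edom (Fs \<mu>)"] Fs_ninf[of \<mu> y] interior_edom_Fs[of \<mu>]
  by (cases "Fs \<mu> y") (auto simp: edom_def)

lemma fs_antimono:
  assumes "admissible \<mu>" "0 < \<mu>'" "\<mu>' \<le> \<mu>" "y \<in> D"
  shows "fs \<mu> y \<le> fs \<mu>' y" "fs \<mu>' y \<le> fs \<mu> y + \<kappa> * (\<mu> - \<mu>')"
proof -
  have adm: "admissible \<mu>'" using assms by (auto intro: le_less_trans[of _ "ereal \<mu>"])
  have "0 \<le> Fs \<mu>' y - Fs \<mu> y \<and> Fs \<mu>' y - Fs \<mu> y \<le> ereal (\<kappa> * (\<mu> - \<mu>'))"
    using smoothing assms adm unfolding smoothing_function_def Let_def by blast
  moreover have "Fs \<mu>' y - Fs \<mu> y = ereal (fs \<mu>' y - fs \<mu> y)"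
    by (subst Fs_real[OF adm assms(4)], subst Fs_real[OF assms(1,4)]) simp
  ultimately show "fs \<mu> y \<le> fs \<mu>' y" "fs \<mu>' y \<le> fs \<mu> y + \<kappa> * (\<mu> - \<mu>')"
    by (simp_all add: zero_ereal_def)
qed

text \<open>Let the smaller parameter in \<open>fs_antimono\<close> tend to 0: pointwise convergence
  replaces \<open>fs \<mu>'\<close> by \<open>F\<close>.\<close>

lemma fs_bounds:
  assumes "admissible \<mu>" "y \<in> D"
  shows "fs \<mu> y \<le> fr y" "fr y \<le> fs \<mu> y + \<kappa> * \<mu>"
proof -
  have "((\<lambda>\<mu>. Fs \<mu> y) \<longlongrightarrow> F y) (at_right 0)"
    using smoothing assms by (simp add: smoothing_function_def Let_def)
  then have lim: "((\<lambda>\<mu>'. fs \<mu>' y) \<longlongrightarrow> fr y) (at_right 0)"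
    using F_real[OF assms(2)] lim_real_of_ereal[of "\<lambda>\<mu>. Fs \<mu> y" "fr y"] by simp
  have near: "\<forall>\<^sub>F \<mu>' in at_right 0. 0 < \<mu>' \<and> \<mu>' < \<mu>"
    using assms(1) eventually_at_right_less[of 0] eventually_at_right[of 0 \<mu>]
    by (auto intro: eventually_conj)
  have lower: "\<forall>\<^sub>F \<mu>' in at_right 0. fs \<mu> y \<le> fs \<mu>' y"
    using near by (rule eventually_mono) (use fs_antimono assms in auto)
  have upper: "\<forall>\<^sub>F \<mu>' in at_right 0. fs \<mu>' y \<le> fs \<mu> y + \<kappa> * \<mu>"
    using near
  proof (rule eventually_mono)
    fix \<mu>' assume "0 < \<mu>' \<and> \<mu>' < \<mu>"
    moreover from this have "\<kappa> * (\<mu> - \<mu>') \<le> \<kappa> * \<mu>" using constants by simp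
    ultimately show "fs \<mu>' y \<le> fs \<mu> y + \<kappa> * \<mu>"
      using fs_antimono(2)[of \<mu> \<mu>' y] assms by linarith
  qed
  show "fs \<mu> y \<le> fr y" by (rule tendsto_lowerbound[OF lim lower]) simp
  show "fr y \<le> fs \<mu> y + \<kappa> * \<mu>" by (rule tendsto_upperbound[OF lim upper]) simp
qed

lemma fs_GDERIV:
  assumes "admissible \<mu>" "y \<in> D"
  shows "GDERIV (fs \<mu>) y :> gradient (Fs \<mu>) y"
proof -
  obtain d where "GDERIV (fs \<mu>) y :> d"
    using smoothing assms by (force simp: smoothing_function_def Let_def)
  then show ?thesis using gradient_eqI by metis
qed

lemma gradient_lipschitz: "admissible \<mu> \<Longrightarrow> (lipc \<mu>)-lipschitz_on D (gradient (Fs \<mu>))"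
  using smoothing by (simp add: smoothing_function_def Let_def)

lemma limiting_subdiff_Fs:
  assumes "admissible \<mu>" "y \<in> D"
  shows "limiting_subdiff (Fs \<mu>) y = {gradient (Fs \<mu>) y}"
  using assms fs_GDERIV gradient_lipschitz[OF assms(1)] Fs_ninf
  by (intro limiting_subdiff_smooth)
     (auto simp: interior_edom_Fs intro: lipschitz_on_continuous_on)

text \<open>The half of the gradient consistency condition that makes limits of smoothed gradients
  subgradients of \<open>F\<close>; the cluster point argument reaches \<open>F\<close> through
  it.\<close>

lemma limiting_subdiff_F:
  assumes "y \<in> D" "\<And>n. xs n \<in> D" "\<And>n. admissible (ms n)" "xs \<longlonglongrightarrow> y" "decseq ms" "ms \<longlonglongrightarrow> 0"
    "(\<lambda>n. gradient (Fs (ms n)) (xs n)) \<longlonglongrightarrow> v"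
  shows "v \<in> limiting_subdiff F y"
proof -
  have "limiting_subdiff F y =
          {v. \<exists>xs ms. (\<forall>n. xs n \<in> D) \<and> (\<forall>n. ms n \<in> {\<mu>. admissible \<mu>}) \<and> xs \<longlonglongrightarrow> y \<and>
                decseq ms \<and> ms \<longlonglongrightarrow> 0 \<and> (\<lambda>n. gradient (Fs (ms n)) (xs n)) \<longlonglongrightarrow> v}"
    using smoothing assms(1) unfolding smoothing_function_def Let_def by blast
  then show ?thesis using assms by blast
qed

text \<open>Compare the first-order model of the smoothed function with the Lipschitz bound on \<^term>\<open>F\<close>
  after a step of length \<open>\<mu>\<close>: at this length the smoothing error \<open>\<kappa> \<mu>\<close> and the curvature
  term \<open>lipc \<mu> \<mu>\<^sup>2\<close> are both of order \<open>\<mu>\<close>.\<close>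

lemma gradient_bound:
  assumes \<mu>: "admissible \<mu>" and U: "K-lipschitz_on U fr" "cball y \<mu> \<subseteq> U \<inter> D"
  shows "norm (gradient (Fs \<mu>) y) \<le> K + \<kappa> + (w1 * \<mu> + w2) / 2"
proof (cases "gradient (Fs \<mu>) y = 0")
  case True
  then show ?thesis using lipschitz_on_nonneg[OF U(1)] constants \<mu> by simp
next
  case False
  let ?g = "gradient (Fs \<mu>) y"
  define z where "z = y + (\<mu> / norm ?g) *\<^sub>R ?g"
  have n: "norm (z - y) = \<mu>" "?g \<bullet> (z - y) = \<mu> * norm ?g"
    using False \<mu> by (simp_all add: z_def dot_square_norm power2_eq_square)
  have y: "y \<in> U" "y \<in> D" and z: "z \<in> U" "z \<in> D"
    using U(2) n \<mu> by (auto simp: subset_eq dist_norm norm_minus_commute)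
  have "fs \<mu> y + ?g \<bullet> (z - y) - lipc \<mu> / 2 * (norm (z - y))\<^sup>2 \<le> fs \<mu> z"
    by (rule descent_lemma_lower[OF convex_D y(2) z(2) fs_GDERIV gradient_lipschitz]) (use \<mu> in auto)
  also have "\<dots> \<le> fr z" using fs_bounds[OF \<mu> z(2)] by simp
  also have "\<dots> \<le> fr y + K * \<mu>"
    using lipschitz_onD[OF U(1) z(1) y(1)] n by (simp add: dist_norm)
  also have "\<dots> \<le> fs \<mu> y + \<kappa> * \<mu> + K * \<mu>" using fs_bounds[OF \<mu> y(2)] by simp
  finally have "\<mu> * norm ?g \<le> \<kappa> * \<mu> + K * \<mu> + lipc \<mu> / 2 * \<mu>\<^sup>2"
    unfolding n by simp
  also have "\<dots> = \<mu> * (K + \<kappa> + (w1 * \<mu> + w2) / 2)"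
    using \<mu> by (simp add: field_simps power2_eq_square)
  finally show ?thesis using \<mu> by simp
qed

end

section \<open>Runs of the algorithm\<close>

locale smoothing_run = smoothing F mt Fs \<kappa> w1 w2
  for F :: "'a::euclidean_space \<Rightarrow> ereal" and mt Fs \<kappa> w1 w2 +
  fixes \<phi> :: "'a \<Rightarrow> ereal" and c \<rho> ginit \<theta> :: real
    and \<mu> \<gamma> R :: "nat \<Rightarrow> real" and x :: "nat \<Rightarrow> 'a"
  assumes proper_phi: "proper_fun \<phi>"
    and edom_phi: "edom \<phi> \<subseteq> D"
    and bounded_below: "(INF y. F y + \<phi> y) > -\<infinity>"
    and c: "0 < c" "c < 1 / 2" and \<rho>: "0 < \<rho>" "\<rho> < 1" and ginit: "0 < ginit" and \<theta>: "0 < \<theta>"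
    and \<mu>: "n \<ge> 1 \<Longrightarrow> admissible (\<mu> n)" and \<mu>_antimono: "antimono_on {1..} \<mu>"
    and run: "prox_variable_smoothing_run \<phi> Fs \<kappa> c \<rho> ginit \<theta> \<mu> x \<gamma> R"
begin

abbreviation h :: "'a \<Rightarrow> real" where "h y \<equiv> real_of_ereal (\<phi> y)"
abbreviation f :: "nat \<Rightarrow> 'a \<Rightarrow> real" where "f n \<equiv> fs (\<mu> n)"
abbreviation g :: "nat \<Rightarrow> 'a" where "g n \<equiv> gradient (Fs (\<mu> n)) (x n)"
abbreviation Lip :: "nat \<Rightarrow> real" where "Lip n \<equiv> lipc (\<mu> n)"
abbreviation res :: "nat \<Rightarrow> real" where "res n \<equiv> norm ((x n - x (n + 1)) /\<^sub>R \<gamma> n)"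
abbreviation Rhat :: "nat \<Rightarrow> real" where "Rhat n \<equiv> R n + \<kappa> * \<mu> n"
abbreviation M :: "nat \<Rightarrow> ereal" where "M n \<equiv> stationarity_measure (\<gamma> n) (Fs (\<mu> n)) \<phi> (x n)"
abbreviation Mr :: "nat \<Rightarrow> real" where "Mr n \<equiv> real_of_ereal (M n)"
abbreviation \<beta> :: real where "\<beta> \<equiv> min (ginit * Lip 1) (\<rho> * (1 - 2 * c))"

lemma \<mu>_mono: "1 \<le> m \<Longrightarrow> m \<le> n \<Longrightarrow> \<mu> n \<le> \<mu> m"
  using \<mu>_antimono by (auto simp: monotone_on_def)

lemma phi_ninf: "\<phi> y \<noteq> -\<infinity>"
  using proper_phi by (simp add: proper_fun_def)

lemma phi_real: "y \<in> edom \<phi> \<Longrightarrow> \<phi> y = ereal (h y)"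
  using phi_ninf[of y] by (cases "\<phi> y") (auto simp: edom_def)

lemma objective_real:
  assumes "n \<ge> 1" "y \<in> edom \<phi>"
  shows "Fs (\<mu> n) y + \<phi> y = ereal (f n y + h y)"
  using Fs_real[OF \<mu>[OF assms(1)], of y] phi_real[OF assms(2)] assms(2) edom_phi
  by (metis plus_ereal.simps(1) subsetD)

lemma \<beta>_pos: "0 < \<beta>"
  using c \<rho> ginit lipc_pos \<mu>[of 1] by simp

section \<open>Decrease of the reference values\<close>

lemma loop: "n \<ge> 1 \<Longrightarrow> backtracking_loop (Fs (\<mu> n)) \<phi> c \<rho> ginit (R n) (x n) (x (n + 1)) (\<gamma> n)"
  using run by (simp add: prox_variable_smoothing_run_def)

lemma
  assumes n: "n \<ge> 1"
  shows iterate_in_prox: "x (n + 1) \<in> prox (\<gamma> n) \<phi> (x n - \<gamma> n *\<^sub>R g n)"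
    and stepsize_pos: "0 < \<gamma> n" and stepsize_le: "\<gamma> n \<le> ginit"
    and accepted: "Fs (\<mu> n) (x (n + 1)) + \<phi> (x (n + 1)) \<le> ereal (R n - c * \<gamma> n * (res n)\<^sup>2)"
proof -
  obtain l p where "\<forall>j\<le>l. p j \<in> prox (\<rho> ^ j * ginit) \<phi> (x n - (\<rho> ^ j * ginit) *\<^sub>R g n)"
    "Fs (\<mu> n) (p l) + \<phi> (p l) \<le>
      ereal (R n - c * (\<rho> ^ l * ginit) * (norm ((x n - p l) /\<^sub>R (\<rho> ^ l * ginit)))\<^sup>2)"
    "x (n + 1) = p l" "\<gamma> n = \<rho> ^ l * ginit"
    using loop[OF n] unfolding backtracking_loop_def Let_def by blast
  moreover have "\<rho> ^ l \<le> 1" using \<rho> by (simp add: power_le_one)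
  ultimately show "x (n + 1) \<in> prox (\<gamma> n) \<phi> (x n - \<gamma> n *\<^sub>R g n)" "0 < \<gamma> n" "\<gamma> n \<le> ginit"
    "Fs (\<mu> n) (x (n + 1)) + \<phi> (x (n + 1)) \<le> ereal (R n - c * \<gamma> n * (res n)\<^sup>2)"
    using \<rho> ginit by (simp_all add: mult_le_cancel_right1)
qed

lemma iterate_in_edom: "n \<ge> 1 \<Longrightarrow> x n \<in> edom \<phi>"
proof (induction n rule: nat_induct_at_least)
  case base
  show ?case using run by (simp add: prox_variable_smoothing_run_def)
next
  case (Suc n)
  then show ?case using prox_in_edom[OF proper_phi iterate_in_prox[of n]] by simp
qed

lemma iterate_in_D: "n \<ge> 1 \<Longrightarrow> x n \<in> D"
  using iterate_in_edom edom_phi by blast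

text \<open>The acceptance test bounds the new point under the old parameter. Passing to the smaller
  parameter costs at most \<open>\<kappa> * (\<mu> n - \<mu> (n + 1))\<close>, which is exactly the
  correction built into the recursion for \<open>R\<close>.\<close>

lemma next_objective_le:
  assumes n: "n \<ge> 1"
  shows "f (n + 1) (x (n + 1)) + h (x (n + 1)) \<le>
    R n + \<kappa> * (\<mu> n - \<mu> (n + 1)) - c * \<gamma> n * (res n)\<^sup>2"
proof -
  have "f n (x (n + 1)) + h (x (n + 1)) \<le> R n - c * \<gamma> n * (res n)\<^sup>2"
    using accepted[OF n] objective_real[of n "x (n + 1)"] iterate_in_edom[of "n + 1"] n by simp
  moreover have "f (n + 1) (x (n + 1)) \<le> f n (x (n + 1)) + \<kappa> * (\<mu> n - \<mu> (n + 1))"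
    using n \<mu> \<mu>_mono iterate_in_D by (intro fs_antimono) auto
  ultimately show ?thesis by simp
qed

lemma reference_1: "R 1 = f 1 (x 1) + h (x 1)"
  using run objective_real[of 1 "x 1"] iterate_in_edom[of 1]
  by (simp add: prox_variable_smoothing_run_def)

lemma reference_step:
  assumes n: "n \<ge> 1"
  obtains t where "\<theta> \<le> t" "t \<le> 1"
    "R (n + 1) = t * (f (n + 1) (x (n + 1)) + h (x (n + 1))) + (1 - t) * (R n + \<kappa> * (\<mu> n - \<mu> (n + 1)))"
proof -
  obtain \<theta>s where "\<forall>n>1. \<theta> \<le> \<theta>s n \<and> \<theta>s n \<le> 1 \<and>
        ereal (R n) = ereal (\<theta>s n) * (Fs (\<mu> n) (x n) + \<phi> (x n))
          + ereal ((1 - \<theta>s n) * (R (n - 1) + \<kappa> * (\<mu> (n - 1) - \<mu> n)))"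
    using run unfolding prox_variable_smoothing_run_def by blast
  from this[rule_format, of "n + 1"] n
  show thesis using objective_real[of "n + 1" "x (n + 1)"] iterate_in_edom[of "n + 1"]
    by (intro that[of "\<theta>s (n + 1)"]) auto
qed

text \<open>The new reference is a convex combination of the new objective and the corrected old
  reference, and the latter is at least the new objective by
  \<open>next_objective_le\<close>.\<close>

lemma objective_le_reference: "n \<ge> 1 \<Longrightarrow> f n (x n) + h (x n) \<le> R n"
proof (induction n rule: nat_induct_at_least)
  case base
  show ?case using reference_1 by simp
next
  case (Suc n)
  obtain t where t: "\<theta> \<le> t" "t \<le> 1"
    "R (n + 1) = t * (f (n + 1) (x (n + 1)) + h (x (n + 1))) + (1 - t) * (R n + \<kappa> * (\<mu> n - \<mu> (n + 1)))"
    using reference_step[OF Suc(1)] by blast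
  let ?a = "f (n + 1) (x (n + 1)) + h (x (n + 1))"
  have "0 \<le> c * \<gamma> n * (res n)\<^sup>2" using c stepsize_pos[OF Suc(1)] by simp
  then have "?a \<le> R n + \<kappa> * (\<mu> n - \<mu> (n + 1))"
    using next_objective_le[OF Suc(1)] by linarith
  then have "(1 - t) * ?a \<le> (1 - t) * (R n + \<kappa> * (\<mu> n - \<mu> (n + 1)))"
    using t by (intro mult_left_mono) auto
  moreover have "?a = t * ?a + (1 - t) * ?a" by (simp add: algebra_simps)
  ultimately show ?case using t(3) by simp
qed

text \<open>Adding \<open>\<kappa> * \<mu> n\<close> to \<open>R n\<close> absorbs the correction
  terms. The new objective carries weight at least \<open>\<theta>\<close> in the average, so at
  least this share of the decrease survives.\<close>

lemma Rhat_decrease: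
  assumes n: "n \<ge> 1"
  shows "\<theta> * c * \<gamma> n * (res n)\<^sup>2 \<le> Rhat n - Rhat (n + 1)"
proof -
  obtain t where t: "\<theta> \<le> t" "t \<le> 1"
    "R (n + 1) = t * (f (n + 1) (x (n + 1)) + h (x (n + 1))) + (1 - t) * (R n + \<kappa> * (\<mu> n - \<mu> (n + 1)))"
    using reference_step[OF n] by blast
  let ?r = "c * \<gamma> n * (res n)\<^sup>2"
  have "t * (f (n + 1) (x (n + 1)) + h (x (n + 1))) \<le> t * (R n + \<kappa> * (\<mu> n - \<mu> (n + 1)) - ?r)"
    using next_objective_le[OF n] t \<theta> by (intro mult_left_mono) auto
  then have "R (n + 1) \<le> R n + \<kappa> * (\<mu> n - \<mu> (n + 1)) - t * ?r"
    using t(3) by (simp add: algebra_simps)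
  moreover have "\<theta> * ?r \<le> t * ?r"
    using t c stepsize_pos[OF n] by (intro mult_right_mono) auto
  ultimately show ?thesis by (simp add: algebra_simps)
qed

text \<open>\<open>F\<close> exceeds its smoothing by at most \<open>\<kappa> * \<mu> n\<close>, the
  amount by which \<open>Rhat n\<close> exceeds \<open>R n\<close>.\<close>

lemma Rhat_ge:
  assumes n: "n \<ge> 1"
  shows "F (x n) + \<phi> (x n) \<le> ereal (Rhat n)"
proof -
  have "F (x n) + \<phi> (x n) = ereal (fr (x n) + h (x n))"
    by (subst F_real[OF iterate_in_D[OF n]], subst phi_real[OF iterate_in_edom[OF n]]) simp
  then show ?thesis
    using fs_bounds(2)[OF \<mu> iterate_in_D, OF n n] objective_le_reference[OF n] by simp
qed

section \<open>Acceptance of short steps and the lower bound on the stepsize\<close>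

lemma trial_accepted:
  assumes n: "n \<ge> 1" and s: "0 < s" "s * Lip n \<le> 1 - 2 * c"
    and p: "p \<in> prox s \<phi> (x n - s *\<^sub>R g n)"
  shows "Fs (\<mu> n) p + \<phi> p \<le> ereal (R n - c * s * (norm ((x n - p) /\<^sub>R s))\<^sup>2)"
proof -
  \<comment> \<open>The proximal inequality at \<open>x n\<close> and the descent lemma at
    \<open>p\<close> are added; the gradient terms cancel and the objective drops by at least
    \<open>(1 / (2 * s) - Lip n / 2) * ?q\<close>. The condition on \<open>s\<close> makes this at
    least \<open>c / s * ?q\<close>, and the test compares with \<open>R n\<close>, which dominates
    the current objective.\<close>
  let ?q = "(norm (x n - p))\<^sup>2"
  have pe: "p \<in> edom \<phi>" using prox_in_edom[OF proper_phi p] .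
  have "ereal (h p + ((x n - s *\<^sub>R g n - p) /\<^sub>R s) \<bullet> (x n - p) - 1 / (2 * s) * ?q) \<le> \<phi> (x n)"
    by (rule prox_ineq[OF proper_phi s(1) p phi_real[OF pe]])
  then have "h p + ((x n - s *\<^sub>R g n - p) /\<^sub>R s) \<bullet> (x n - p) - 1 / (2 * s) * ?q \<le> h (x n)"
    by (subst (asm) phi_real[OF iterate_in_edom[OF n]]) simp
  moreover have "((x n - s *\<^sub>R g n - p) /\<^sub>R s) \<bullet> (x n - p) = ?q / s - g n \<bullet> (x n - p)"
    using s(1) unfolding power2_norm_eq_inner
    by (simp add: inner_diff_left divide_inverse algebra_simps)
  ultimately have "h p \<le> h (x n) + g n \<bullet> (x n - p) - 1 / (2 * s) * ?q"
    using s(1) by (simp add: field_simps)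
  moreover have "f n p \<le> f n (x n) + g n \<bullet> (p - x n) + Lip n / 2 * (norm (p - x n))\<^sup>2"
    by (rule descent_lemma[OF convex_D iterate_in_D[OF n] _ fs_GDERIV[OF \<mu>[OF n]] gradient_lipschitz[OF \<mu>[OF n]]])
      (use pe edom_phi in auto)
  moreover have "g n \<bullet> (x n - p) + g n \<bullet> (p - x n) = 0"
    by (simp add: inner_diff_right)
  moreover have "Lip n / 2 * ?q \<le> (1 - 2 * c) / (2 * s) * ?q"
  proof (rule mult_right_mono)
    have "Lip n \<le> (1 - 2 * c) / s" using s by (simp only: pos_le_divide_eq mult.commute)
    then have "Lip n / 2 \<le> (1 - 2 * c) / s / 2" by (rule divide_right_mono) simp
    also have "\<dots> = (1 - 2 * c) / (2 * s)" by simp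
    finally show "Lip n / 2 \<le> (1 - 2 * c) / (2 * s)" .
  qed simp
  moreover have "c * s * (norm ((x n - p) /\<^sub>R s))\<^sup>2 = c / s * ?q"
  proof -
    have "norm ((x n - p) /\<^sub>R s) = norm (x n - p) / s"
      unfolding norm_scaleR using s(1) by (simp add: divide_inverse_commute)
    then show ?thesis using s(1) by (simp only: power_divide) (simp add: power2_eq_square)
  qed
  moreover have "(1 - 2 * c) / (2 * s) * ?q + c / s * ?q = 1 / (2 * s) * ?q"
    using s(1) by (simp add: field_simps)
  ultimately have "f n p + h p \<le> R n - c * s * (norm ((x n - p) /\<^sub>R s))\<^sup>2"
    using objective_le_reference[OF n] by (simp add: norm_minus_commute)
  then show ?thesis using objective_real[OF n pe] by simp
qed

text \<open>If the first trial is accepted, the stepsize is \<open>ginit\<close> and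
  \<open>Lip n\<close> is at least \<open>Lip 1\<close>. Otherwise the trial just before the
  accepted one was rejected, hence too long for \<open>trial_accepted\<close>, and the accepted step
  is \<open>\<rho>\<close> times it. The two cases are the two arguments of the minimum
  \<open>\<beta>\<close>.\<close>

lemma stepsize_lower:
  assumes n: "n \<ge> 1"
  shows "\<beta> \<le> \<gamma> n * Lip n"
proof -
  obtain l p where p: "\<forall>j\<le>l. p j \<in> prox (\<rho> ^ j * ginit) \<phi> (x n - (\<rho> ^ j * ginit) *\<^sub>R g n)"
    and rej: "\<forall>j<l. \<not> Fs (\<mu> n) (p j) + \<phi> (p j) \<le>
      ereal (R n - c * (\<rho> ^ j * ginit) * (norm ((x n - p j) /\<^sub>R (\<rho> ^ j * ginit)))\<^sup>2)"
    and \<gamma>: "\<gamma> n = \<rho> ^ l * ginit"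
    using loop[OF n] unfolding backtracking_loop_def Let_def by blast
  show ?thesis
  proof (cases l)
    case 0
    have "inverse (\<mu> 1) \<le> inverse (\<mu> n)" using \<mu>_mono[of 1 n] n \<mu>[OF n] by (simp add: le_imp_inverse_le)
    then have "Lip 1 \<le> Lip n" using constants by (simp add: mult_left_mono)
    then show ?thesis using ginit by (simp add: \<gamma> 0 min.coboundedI1)
  next
    case (Suc j)
    have "\<not> \<rho> ^ j * ginit * Lip n \<le> 1 - 2 * c"
      using trial_accepted[OF n, of "\<rho> ^ j * ginit" "p j"] p rej \<rho> ginit Suc by auto
    then have "\<rho> * (1 - 2 * c) \<le> \<rho> * (\<rho> ^ j * ginit * Lip n)" using \<rho> by simp
    then show ?thesis by (simp add: \<gamma> Suc mult_ac min.coboundedI2)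
  qed
qed

section \<open>The stationarity measure along the run\<close>

lemma M_nonneg: "0 \<le> M n"
  unfolding stationarity_measure_def by (rule Inf_greatest) auto

text \<open>The next iterate is one of the proximal points over which the infimum is taken. This
  also makes \<open>M n\<close> finite, so that the estimates can be carried out with the real
  number \<open>Mr n\<close>.\<close>

lemma M_le:
  assumes n: "n \<ge> 1"
  shows "M n \<le> ereal (res n)"
  unfolding stationarity_measure_def
  using iterate_in_prox[OF n] limiting_subdiff_Fs[OF \<mu> iterate_in_D, OF n n]
  by (intro Inf_lower) blast

lemma M_real: "n \<ge> 1 \<Longrightarrow> M n = ereal (Mr n)"
  using M_nonneg[of n] M_le[of n] by (cases "M n") auto

lemma M_square_real: "n \<ge> 1 \<Longrightarrow> ereal a * (M n)\<^sup>2 = ereal (a * (Mr n)\<^sup>2)"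
  using M_nonneg[of n] M_le[of n] by (cases "M n") auto

lemma Mr_nonneg: "0 \<le> Mr n"
  using M_nonneg by (rule real_of_ereal_pos)

lemma Rhat_decrease_M:
  assumes n: "n \<ge> 1"
  shows "\<theta> * c * \<gamma> n * (Mr n)\<^sup>2 \<le> Rhat n - Rhat (n + 1)"
proof -
  have "Mr n \<le> res n" using M_le[OF n] M_real[OF n] by (metis ereal_less_eq(3))
  then have "(Mr n)\<^sup>2 \<le> (res n)\<^sup>2" using Mr_nonneg by (simp add: power_mono)
  then have "\<theta> * c * \<gamma> n * (Mr n)\<^sup>2 \<le> \<theta> * c * \<gamma> n * (res n)\<^sup>2"
    using \<theta> c stepsize_pos[OF n] by (intro mult_left_mono) auto
  with Rhat_decrease[OF n] show ?thesis by simp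
qed

lemma sublevel_subset: "{y. F y + \<phi> y \<le> ereal a} \<subseteq> edom \<phi>"
proof
  fix y assume "y \<in> {y. F y + \<phi> y \<le> ereal a}"
  then show "y \<in> edom \<phi>"
    using F_ninf[of y] by (cases "F y"; cases "\<phi> y") (auto simp: edom_def)
qed

lemma Rhat_antimono:
  assumes "1 \<le> m" "m \<le> n"
  shows "Rhat n \<le> Rhat m"
  using assms(2)
proof (induction n rule: dec_induct)
  case (step n)
  then have "0 \<le> \<theta> * c * \<gamma> n * (Mr n)\<^sup>2" using \<theta> c stepsize_pos[of n] assms(1) by simp
  then show ?case using Rhat_decrease_M[of n] step assms(1) by simp
qed simp

lemma iterate_in_sublevel: "n \<ge> 1 \<Longrightarrow> F (x n) + \<phi> (x n) \<le> ereal (Rhat 1)"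
  by (rule order_trans[OF Rhat_ge]) (use Rhat_antimono[of 1 n] in auto)

section \<open>The bound on the weighted sum and the convergence rate\<close>

definition inf_val :: real where
  "inf_val = real_of_ereal (INF y. F y + \<phi> y)"

lemma inf_val: "(INF y. F y + \<phi> y) = ereal inf_val"
proof -
  have "(INF y. F y + \<phi> y) \<le> F (x 1) + \<phi> (x 1)" by (rule INF_lower) simp
  also have "\<dots> \<le> ereal (Rhat 1)" using Rhat_ge[of 1] by simp
  finally show ?thesis using bounded_below unfolding inf_val_def
    by (cases "INF y. F y + \<phi> y") auto
qed

lemma inf_val_le_Rhat:
  assumes "n \<ge> 1" shows "inf_val \<le> Rhat n"
proof -
  have "ereal inf_val \<le> F (x n) + \<phi> (x n)" unfolding inf_val[symmetric] by (rule INF_lower) simp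
  also have "\<dots> \<le> ereal (Rhat n)" by (rule Rhat_ge[OF assms])
  finally show ?thesis by simp
qed

definition chi_val :: real where
  "chi_val = (fr (x 1) + h (x 1) + \<kappa> * \<mu> 1 - inf_val) * (w1 + inverse (\<mu> 1) * w2)
     / (\<theta> * c * \<beta> * inverse (\<mu> 1))"

lemma chi_eq:
  "(F (x 1) + \<phi> (x 1) + ereal (\<kappa> * \<mu> 1) - (INF y. F y + \<phi> y))
     * ereal (w1 + inverse (\<mu> 1) * w2) / ereal (\<theta> * c * \<beta> * inverse (\<mu> 1)) = ereal chi_val"
proof -
  define b where "b = \<theta> * c * \<beta> * inverse (\<mu> 1)"
  have "0 < b" unfolding b_def using \<theta> c \<beta>_pos \<mu>[of 1] by (intro mult_pos_pos) auto
  moreover have "(u + v + ereal t - ereal i) * ereal l / ereal q = ereal ((u' + v' + t - i) * l / q)"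
    if "0 < q" "u = ereal u'" "v = ereal v'" for u v t i l q u' v'
    using that by simp
  ultimately show ?thesis
    unfolding chi_val_def inf_val b_def[symmetric]
    using F_real[OF iterate_in_D] phi_real[OF iterate_in_edom] by blast
qed

text \<open>The gap between the initial objective and the infimum may vanish; strict positivity
  comes from the term \<open>\<kappa> * \<mu> 1\<close>.\<close>

lemma chi_val_pos: "0 < chi_val"
proof -
  have "ereal inf_val \<le> F (x 1) + \<phi> (x 1)" unfolding inf_val[symmetric] by (rule INF_lower) simp
  also have "\<dots> = ereal (fr (x 1) + h (x 1))"
    using F_real[OF iterate_in_D, of 1] phi_real[OF iterate_in_edom, of 1] by (metis order_refl plus_ereal.simps(1))
  finally have "inf_val \<le> fr (x 1) + h (x 1)" by simp
  moreover have "0 < \<kappa> * \<mu> 1" "0 < \<mu> 1" using constants \<mu>[of 1] by auto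
  ultimately show ?thesis
    unfolding chi_val_def using lipc_pos[of "\<mu> 1"] \<theta> c \<beta>_pos
    by (intro divide_pos_pos mult_pos_pos) (auto simp: mult.commute)
qed

text \<open>By \<open>stepsize_lower\<close>, \<open>\<mu> n\<close> is at most a constant multiple
  of \<open>\<gamma> n\<close>, uniformly in \<open>n\<close>, because
  \<open>\<mu> n * Lip n = w1 * \<mu> n + w2\<close> is largest at \<open>n = 1\<close>. The
  decrease of \<open>Rhat\<close> then bounds each summand by a difference, and the sum
  telescopes.\<close>

lemma sum_M_le:
  assumes k: "1 \<le> k1" "k1 \<le> k2"
  shows "(\<Sum>n=k1..k2. \<mu> n * (Mr n)\<^sup>2) \<le> chi_val"
proof -
  \<comment> \<open>\<open>C\<close> is \<open>chi_val\<close> without its first factor. Cancelling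
    \<open>inverse (\<mu> 1)\<close> brings it to the form that matches the bound on
    \<open>\<mu> n * Lip n\<close>.\<close>
  define C where "C = (w1 + inverse (\<mu> 1) * w2) / (\<theta> * c * \<beta> * inverse (\<mu> 1))"
  have \<mu>1: "0 < \<mu> 1" using \<mu>[of 1] by simp
  have C: "C = (w1 * \<mu> 1 + w2) / (\<theta> * c * \<beta>)" "0 \<le> C"
  proof -
    have *: "(w1 + inverse (\<mu> 1) * w2) / (b * inverse (\<mu> 1)) = (w1 * \<mu> 1 + w2) / b" if "0 < b" for b
      using \<mu>1 that by (simp add: field_simps)
    show "C = (w1 * \<mu> 1 + w2) / (\<theta> * c * \<beta>)"
      unfolding C_def by (intro * mult_pos_pos \<theta> c \<beta>_pos)
    then show "0 \<le> C" using \<mu>1 constants \<theta> c \<beta>_pos by simp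
  qed
  have step: "\<mu> n * (Mr n)\<^sup>2 \<le> C * (Rhat n - Rhat (n + 1))" if n: "n \<ge> 1" for n
  proof -
    have \<mu>n: "0 < \<mu> n" using \<mu>[OF n] by simp
    have "\<mu> n * \<beta> \<le> \<mu> n * (\<gamma> n * Lip n)" using stepsize_lower[OF n] \<mu>n by (intro mult_left_mono) auto
    also have "\<dots> = \<gamma> n * (w1 * \<mu> n + w2)" using \<mu>n by (simp add: field_simps)
    also have "\<dots> \<le> \<gamma> n * (w1 * \<mu> 1 + w2)"
      using stepsize_pos[OF n] constants \<mu>_mono[of 1 n] n by (simp add: mult_left_mono)
    finally have "\<mu> n \<le> C * (\<theta> * c * \<gamma> n)"
      unfolding C using \<beta>_pos \<theta> c by (simp add: pos_le_divide_eq mult_ac)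
    then have "\<mu> n * (Mr n)\<^sup>2 \<le> C * (\<theta> * c * \<gamma> n) * (Mr n)\<^sup>2" by (rule mult_right_mono) simp
    also have "\<dots> \<le> C * (Rhat n - Rhat (n + 1))"
      using mult_left_mono[OF Rhat_decrease_M[OF n] C(2)] by (simp add: mult_ac)
    finally show ?thesis .
  qed
  have "(\<Sum>n=k1..k2. \<mu> n * (Mr n)\<^sup>2) \<le> (\<Sum>n=k1..k2. C * (Rhat n - Rhat (Suc n)))"
    using step k by (intro sum_mono) auto
  also have "\<dots> = C * (Rhat k1 - Rhat (Suc k2))"
  proof -
    have "(\<Sum>n=k1..k2. r n - r (Suc n)) = r k1 - r (Suc k2)" for r :: "nat \<Rightarrow> real"
      using k(2) by (induction rule: dec_induct) auto
    from this[of Rhat] show ?thesis by (simp only: sum_distrib_left[symmetric])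
  qed
  \<comment> \<open>\<open>Rhat k1\<close> is at most \<open>Rhat 1\<close>, in which the smoothed
    value at \<open>x 1\<close> is at most the value of \<open>F\<close>;
    \<open>Rhat (Suc k2)\<close> is at least the infimum.\<close>
  also have "\<dots> \<le> C * (fr (x 1) + h (x 1) + \<kappa> * \<mu> 1 - inf_val)"
    using Rhat_antimono[of 1 k1] inf_val_le_Rhat[of "Suc k2"] k reference_1
      fs_bounds(1)[OF \<mu> iterate_in_D, of 1 1] C(2)
    by (intro mult_left_mono) auto
  also have "\<dots> = chi_val" by (simp add: C_def chi_val_def)
  finally show ?thesis .
qed

lemma ereal_sum_M:
  assumes "1 \<le> k1"
  shows "(\<Sum>n=k1..k2. ereal (\<mu> n) * (M n)\<^sup>2) = ereal (\<Sum>n=k1..k2. \<mu> n * (Mr n)\<^sup>2)"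
proof -
  have "(\<Sum>n=k1..k2. ereal (\<mu> n) * (M n)\<^sup>2) = (\<Sum>n=k1..k2. ereal (\<mu> n * (Mr n)\<^sup>2))"
    by (intro sum.cong refl M_square_real) (use assms in simp)
  then show ?thesis by simp
qed

lemma Min_M_real:
  assumes k: "1 \<le> k1" "k1 \<le> k2"
  shows "Min (M ` {k1..k2}) = ereal (Min (Mr ` {k1..k2}))"
proof -
  have "M ` {k1..k2} = ereal ` (Mr ` {k1..k2})"
    unfolding image_image by (intro image_cong refl M_real) (use k in simp)
  moreover have "Min (ereal ` A) = ereal (Min A)" if "finite A" "A \<noteq> {}" for A
    using that by (intro mono_Min_commute[symmetric]) (auto simp: mono_def)
  ultimately show ?thesis using k by simp
qed

lemma Min_Mr_le:
  assumes k: "1 \<le> k1" "k1 \<le> k2"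
  shows "Min (Mr ` {k1..k2}) \<le> sqrt (chi_val / (\<Sum>n=k1..k2. \<mu> n))"
proof -
  let ?m = "Min (Mr ` {k1..k2})" and ?S = "\<Sum>n=k1..k2. \<mu> n"
  have S: "0 < ?S" using \<mu> k by (intro sum_pos) auto
  have m: "0 \<le> ?m" using Mr_nonneg k by simp
  have "?S * ?m\<^sup>2 = (\<Sum>n=k1..k2. \<mu> n * ?m\<^sup>2)" by (simp add: sum_distrib_right)
  also have "\<dots> \<le> (\<Sum>n=k1..k2. \<mu> n * (Mr n)\<^sup>2)"
    using \<mu> k m by (intro sum_mono mult_left_mono power_mono) (auto intro: less_imp_le)
  also have "\<dots> \<le> chi_val" by (rule sum_M_le[OF k])
  finally have "?m\<^sup>2 \<le> chi_val / ?S" using S by (simp add: field_simps)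
  then show ?thesis by (rule real_le_rsqrt)
qed

text \<open>As \<open>\<mu>\<close> is nonincreasing, the sum up to \<open>k\<close> is at least
  \<open>k * \<mu> k\<close>, that is \<open>\<tau>\<close> times \<open>k\<close> to the power
  \<open>(\<alpha> - 1) / \<alpha>\<close>. The square root in \<open>Min_Mr_le\<close> halves the
  exponent.\<close>

lemma Min_M_bigo:
  assumes \<tau>: "0 < \<tau>" and \<alpha>: "1 < \<alpha>" and eq: "\<And>n. n \<ge> 1 \<Longrightarrow> \<mu> n = \<tau> * real n powr (- 1 / \<alpha>)"
  shows "(\<lambda>k. real_of_ereal (Min (M ` {1..k}))) \<in> O(\<lambda>k. real k powr (- (\<alpha> - 1) / (2 * \<alpha>)))"
proof (rule bigoI)
  show "\<forall>\<^sub>F k in sequentially. norm (real_of_ereal (Min (M ` {1..k})))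
    \<le> sqrt (chi_val / \<tau>) * norm (real k powr (- (\<alpha> - 1) / (2 * \<alpha>)))"
    using eventually_ge_at_top[of 1]
  proof eventually_elim
    case (elim k)
    have "(\<Sum>n=1..k. \<mu> k) \<le> (\<Sum>n=1..k. \<mu> n)" using \<mu>_mono by (intro sum_mono) auto
    moreover have "(\<Sum>n=1..k. \<mu> k) = \<tau> * (real k powr 1 * real k powr (- 1 / \<alpha>))"
      using eq[OF elim] elim by simp
    ultimately have S: "\<tau> * real k powr ((\<alpha> - 1) / \<alpha>) \<le> (\<Sum>n=1..k. \<mu> n)"
      using \<alpha> unfolding powr_add[symmetric] by (simp add: field_simps)
    have pos: "0 < \<tau> * real k powr ((\<alpha> - 1) / \<alpha>)" using \<tau> elim by simp
    have "Min (Mr ` {1..k}) \<le> sqrt (chi_val / (\<Sum>n=1..k. \<mu> n))"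
      using elim by (intro Min_Mr_le) auto
    also have "\<dots> \<le> sqrt (chi_val / (\<tau> * real k powr ((\<alpha> - 1) / \<alpha>)))"
      using chi_val_pos
      by (intro real_sqrt_le_mono divide_left_mono S mult_pos_pos[OF less_le_trans[OF pos S] pos]) simp
    also have "\<dots> = sqrt (chi_val / \<tau>) * sqrt (real k powr (- ((\<alpha> - 1) / \<alpha>)))"
      by (simp add: powr_minus divide_inverse real_sqrt_mult)
    also have "sqrt (real k powr (- ((\<alpha> - 1) / \<alpha>))) = real k powr (- (\<alpha> - 1) / (2 * \<alpha>))"
    proof -
      have "- ((\<alpha> - 1) / \<alpha>) * (1 / 2) = - (\<alpha> - 1) / (2 * \<alpha>)" using \<alpha> by (simp add: field_simps)
      then show ?thesis by (simp only: powr_half_sqrt[symmetric] powr_ge_zero powr_powr)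
    qed
    finally have "Min (Mr ` {1..k}) \<le> sqrt (chi_val / \<tau>) * real k powr (- (\<alpha> - 1) / (2 * \<alpha>))" .
    moreover have "0 \<le> Min (Mr ` {1..k})" using Mr_nonneg elim by simp
    ultimately show ?case using Min_M_real[of 1 k] elim by simp
  qed
qed

section \<open>Vanishing of the stationarity measure and cluster points\<close>

lemma liminf_M:
  assumes div: "filterlim (\<lambda>N. \<Sum>n=1..N. \<mu> n) at_top sequentially"
  shows "liminf M = 0"
proof (rule antisym)
  show "0 \<le> liminf M" by (intro Liminf_bounded) (simp add: M_nonneg)
  show "liminf M \<le> 0"
  proof (rule ccontr)
    \<comment> \<open>If the measure eventually stayed above \<open>e\<close>, the weighted sums
      over tails would be at least \<open>e^2\<close> times tail sums of \<open>\<mu>\<close>, which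
      diverge, against the bound \<open>chi_val\<close>.\<close>
    assume "\<not> liminf M \<le> 0"
    then obtain e where e: "0 < ereal e" "ereal e < liminf M"
      using ereal_dense2[of 0 "liminf M"] by (auto simp: not_le)
    have "\<forall>\<^sub>F n in sequentially. ereal e < M n"
      using e(2) le_Liminf_iff[of "liminf M" sequentially M] by blast
    then obtain N where N: "\<And>n. n \<ge> N \<Longrightarrow> ereal e < M n" "N \<ge> 1"
      unfolding eventually_sequentially using that by (meson max.bounded_iff max.cobounded2)
    \<comment> \<open>The index \<open>k\<close> is taken so large that the part of the sum beyond
      \<open>N\<close> alone exceeds \<open>chi_val / e^2\<close>; the \<open>+ 1\<close> makes this
      strict.\<close>
    have "\<forall>\<^sub>F k in sequentially. (\<Sum>n=1..N. \<mu> n) + (chi_val / e\<^sup>2 + 1) \<le> (\<Sum>n=1..k. \<mu> n)"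
      using div unfolding filterlim_at_top by blast
    then obtain k where k: "(\<Sum>n=1..N. \<mu> n) + (chi_val / e\<^sup>2 + 1) \<le> (\<Sum>n=1..k. \<mu> n)" "k \<ge> Suc N"
      using eventually_happens[OF eventually_conj[OF _ eventually_ge_at_top[of "Suc N"]]] by auto
    have "(\<Sum>n=1..k. \<mu> n) = (\<Sum>n=1..N. \<mu> n) + (\<Sum>n=Suc N..k. \<mu> n)"
    proof -
      have "{1..k} = {1..N} \<union> {Suc N..k}" using k(2) by auto
      then show ?thesis by (simp only: sum.union_disjoint finite_atLeastAtMost) (simp add: sum.union_disjoint)
    qed
    with k(1) have "chi_val / e\<^sup>2 < (\<Sum>n=Suc N..k. \<mu> n)" by simp
    then have "chi_val < (\<Sum>n=Suc N..k. \<mu> n * e\<^sup>2)"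
      using e(1) by (simp add: field_simps sum_distrib_left)
    also have "\<dots> \<le> (\<Sum>n=Suc N..k. \<mu> n * (Mr n)\<^sup>2)"
    proof (intro sum_mono mult_left_mono power_mono)
      fix n assume "n \<in> {Suc N..k}"
      then have n: "n \<ge> N" "n \<ge> 1" using N(2) by auto
      show "e \<le> Mr n" using N(1)[OF n(1)] M_real[OF n(2)] by (metis ereal_less_eq(3) less_imp_le)
      show "0 \<le> \<mu> n" using \<mu>[OF n(2)] by simp
    qed (use e in simp)
    also have "\<dots> \<le> chi_val" using k(2) by (intro sum_M_le) auto
    finally show False by simp
  qed
qed

text \<open>If \<open>\<phi> y\<close> were infinite, lower semicontinuity would make
  \<open>\<phi>\<close> arbitrarily large along the iterates while \<open>F\<close> stays above a
  real \<open>b\<close>, so the sum would exceed the level \<open>Rhat 1\<close> that bounds all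
  iterates.\<close>

lemma cluster_point_in_edom:
  assumes lsc: "lsc_fun F" "lsc_fun \<phi>"
    and n: "\<And>k. n k \<ge> 1" and lim: "(\<lambda>k. x (n k)) \<longlonglongrightarrow> y"
  shows "y \<in> edom \<phi>"
proof (rule ccontr)
  assume "y \<notin> edom \<phi>"
  then have inf: "\<phi> y = \<infinity>" by (simp add: edom_def)
  obtain b where b: "ereal b < F y" using F_ninf[of y] ereal_dense2[of "-\<infinity>" "F y"] by auto
  have "\<forall>\<^sub>F k in sequentially. ereal b < F (x (n k)) \<and> ereal (Rhat 1 - b) < \<phi> (x (n k))"
    using lsc_fun_eventually[OF lsc(1) b] lsc_fun_eventually[OF lsc(2), of "ereal (Rhat 1 - b)" y] lim inf
    by (auto intro!: eventually_conj eventually_compose_filterlim[where f = "\<lambda>k. x (n k)"])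
  then obtain k where "ereal b < F (x (n k))" "ereal (Rhat 1 - b) < \<phi> (x (n k))"
    by (auto dest: eventually_happens)
  moreover have "F (x (n k)) + \<phi> (x (n k)) \<le> ereal (Rhat 1)" by (rule iterate_in_sublevel[OF n])
  ultimately show False
    by (cases "F (x (n k))"; cases "\<phi> (x (n k))") auto
qed

text \<open>The optimality condition of the proximal step writes the residual as a subgradient of \<open>\<phi>\<close> at
  the proximal point plus the gradient of the smoothed function, and the gradients stay bounded, so a
  subsequence yields \<open>v \<in> \<partial>F(y)\<close> and \<open>-v \<in> \<partial>\<phi>(y)\<close>. Regularity makes both Frechet subgradients.\<close>

lemma cluster_point_stationary:
  assumes loc_lip: "\<And>y. y \<in> D \<Longrightarrow> locally_lipschitz_at F y"
    and lower_reg: "\<And>y. y \<in> D \<Longrightarrow> lower_regular_at F y"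
    and prox_reg: "\<And>y. y \<in> edom \<phi> \<Longrightarrow> prox_regular_at \<phi> y"
    and osc: "\<And>y. y \<in> edom \<phi> \<Longrightarrow> outer_semicontinuous_at (limiting_subdiff \<phi>) y"
    and \<mu>0: "\<mu> \<longlonglongrightarrow> 0"
    and n: "strict_mono n" "\<And>k. n k \<ge> 1"
    and M0: "(\<lambda>k. M (n k)) \<longlonglongrightarrow> 0"
    and lim: "(\<lambda>k. x (n k)) \<longlonglongrightarrow> y" and y: "y \<in> edom \<phi>"
  shows "frechet_stationary F \<phi> y"
proof -
  have yD: "y \<in> D" using y edom_phi by blast
  have \<mu>n: "(\<lambda>k. \<mu> (n k)) \<longlonglongrightarrow> 0" using LIMSEQ_subseq_LIMSEQ[OF \<mu>0 n(1)] by (simp add: o_def)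
  \<comment> \<open>The measure is an infimum, possibly below the residual of the actual next
    iterate. Therefore proximal points that come within \<open>1 / (k + 1)\<close> of the infimum
    replace the iterates here.\<close>
  have "\<exists>p. p \<in> prox (\<gamma> (n k)) \<phi> (x (n k) - \<gamma> (n k) *\<^sub>R g (n k)) \<and>
      norm ((x (n k) - p) /\<^sub>R \<gamma> (n k)) < Mr (n k) + 1 / real (Suc k)" for k
  proof -
    have "M (n k) < ereal (Mr (n k) + 1 / real (Suc k))"
      by (subst M_real[OF n(2)]) simp
    then show ?thesis
      unfolding stationarity_measure_def[of "\<gamma> (n k)" "Fs (\<mu> (n k))"] Inf_less_iff
      using limiting_subdiff_Fs[OF \<mu> iterate_in_D, OF n(2) n(2), of k] by auto
  qed
  then obtain p where p: "\<And>k. p k \<in> prox (\<gamma> (n k)) \<phi> (x (n k) - \<gamma> (n k) *\<^sub>R g (n k))"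
    and pM: "\<And>k. norm ((x (n k) - p k) /\<^sub>R \<gamma> (n k)) < Mr (n k) + 1 / real (Suc k)"
    by metis
  define d where "d k = (x (n k) - p k) /\<^sub>R \<gamma> (n k)" for k
  have "(\<lambda>k. Mr (n k) + inverse (real (Suc k))) \<longlonglongrightarrow> 0 + 0"
    using M0 by (intro tendsto_add LIMSEQ_inverse_real_of_nat lim_real_of_ereal) (simp add: zero_ereal_def)
  then have d0: "d \<longlonglongrightarrow> 0"
    using pM by (intro Lim_null_comparison[of d "\<lambda>k. Mr (n k) + inverse (real (Suc k))"])
      (auto simp: d_def inverse_eq_divide less_imp_le)
  have px: "p k = x (n k) - \<gamma> (n k) *\<^sub>R d k" for k
    using stepsize_pos[OF n(2), of k] by (simp add: d_def)
  \<comment> \<open>The stepsizes are bounded by \<open>ginit\<close>, so vanishing residuals force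
    \<open>p\<close> to have the same limit as the iterates.\<close>
  have "(\<lambda>k. \<gamma> (n k) *\<^sub>R d k) \<longlonglongrightarrow> 0"
  proof (rule Lim_null_comparison)
    show "\<forall>\<^sub>F k in sequentially. norm (\<gamma> (n k) *\<^sub>R d k) \<le> ginit * norm (d k)"
      using stepsize_pos[OF n(2)] stepsize_le[OF n(2)]
      by (intro always_eventually allI) (simp add: mult_right_mono less_imp_le)
    show "(\<lambda>k. ginit * norm (d k)) \<longlonglongrightarrow> 0"
      using tendsto_mult_left[OF tendsto_norm[OF d0], of ginit] by simp
  qed
  from tendsto_diff[OF lim this] have py: "p \<longlonglongrightarrow> y" by (simp add: px[abs_def])
  have sub: "d k - g (n k) \<in> limiting_subdiff \<phi> (p k)" for k
  proof (rule subsetD[OF frechet_subset_limiting], rule frechet_subdiff_quadraticI)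
    show pe: "\<phi> (p k) = ereal (h (p k))" using phi_real[OF prox_in_edom[OF proper_phi p]] .
    have "d k - g (n k) = (x (n k) - \<gamma> (n k) *\<^sub>R g (n k) - p k) /\<^sub>R \<gamma> (n k)"
      using stepsize_pos[OF n(2), of k] by (simp add: d_def scaleR_diff_right)
    then show "ereal (h (p k) + (d k - g (n k)) \<bullet> (z - p k) - 1 / (2 * \<gamma> (n k)) * (norm (z - p k))\<^sup>2) \<le> \<phi> z" for z
      using prox_ineq[OF proper_phi stepsize_pos[OF n(2)] p pe] by simp
  qed (rule zero_less_one)
  obtain U K where U: "open U" "y \<in> U" "K-lipschitz_on U fr"
    using loc_lip[OF yD] unfolding locally_lipschitz_at_def by blast
  obtain e where e: "e > 0" "ball y e \<subseteq> U \<inter> D"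
    using U yD openE[of "U \<inter> D" y] by (metis IntI open_Int open_interior)
  define B where "B = K + \<kappa> + (w1 * \<mu> 1 + w2) / 2"
  \<comment> \<open>Splitting \<open>e\<close> into halves puts the ball of radius
    \<open>\<mu> (n k)\<close> around the iterate inside the region where \<open>F\<close> is
    Lipschitz, as \<open>gradient_bound\<close> requires.\<close>
  have "\<forall>\<^sub>F k in sequentially. dist (x (n k)) y < e / 2" "\<forall>\<^sub>F k in sequentially. \<mu> (n k) < e / 2"
    using tendstoD[OF lim, of "e/2"] order_tendstoD(2)[OF \<mu>n, of "e/2"] e by auto
  then have "\<forall>\<^sub>F k in sequentially. norm (g (n k)) \<le> B"
  proof eventually_elim
    case (elim k)
    have "cball (x (n k)) (\<mu> (n k)) \<subseteq> ball y e"
    proof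
      fix z assume "z \<in> cball (x (n k)) (\<mu> (n k))"
      then show "z \<in> ball y e" using elim dist_triangle[of y z "x (n k)"] by (simp add: dist_commute)
    qed
    then have "norm (g (n k)) \<le> K + \<kappa> + (w1 * \<mu> (n k) + w2) / 2"
      using e(2) by (intro gradient_bound[OF \<mu>[OF n(2)] U(3)]) auto
    also have "\<dots> \<le> B" using \<mu>_mono[of 1 "n k"] n(2)[of k] constants by (simp add: B_def mult_left_mono)
    finally show ?case .
  qed
  then have "Bseq (\<lambda>k. g (n k))" by (rule BfunI)
  then obtain v s where s: "strict_mono s" "((\<lambda>k. g (n k)) \<circ> s) \<longlonglongrightarrow> v"
    unfolding Bseq_eq_bounded using bounded_imp_convergent_subsequence by blast
  have ns: "strict_mono (n \<circ> s)" using n(1) s(1) by (rule strict_mono_o)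
  have "v \<in> limiting_subdiff F y"
  proof (rule limiting_subdiff_F[OF yD])
    show "(\<lambda>k. x (n (s k))) \<longlonglongrightarrow> y" "(\<lambda>k. \<mu> (n (s k))) \<longlonglongrightarrow> 0"
      using LIMSEQ_subseq_LIMSEQ[OF lim s(1)] LIMSEQ_subseq_LIMSEQ[OF \<mu>n s(1)] by (simp_all add: o_def)
    show "decseq (\<lambda>k. \<mu> (n (s k)))"
      using \<mu>_mono n(2) monoD[OF strict_mono_mono[OF ns]] by (auto simp: decseq_def)
  qed (use s(2) iterate_in_D[OF n(2)] \<mu>[OF n(2)] in \<open>simp_all add: o_def\<close>)
  then have vF: "v \<in> frechet_subdiff F y" using lower_reg[OF yD] by (simp add: lower_regular_at_def)
  \<comment> \<open>Outer semicontinuity is applied along \<open>p\<close>, where the subgradients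
    of \<open>\<phi>\<close> live. It takes the place of convergence of the values
    \<open>\<phi> (p k)\<close>, which the definition of the limiting subdifferential would ask
    for.\<close>
  have "- v \<in> set_Limsup (\<lambda>k. limiting_subdiff \<phi> (p k))"
    unfolding set_Limsup_def mem_Collect_eq
  proof (intro exI conjI allI)
    show "d (s k) - g (n (s k)) \<in> limiting_subdiff \<phi> (p (s k))" for k by (rule sub)
    show "(\<lambda>k. d (s k) - g (n (s k))) \<longlonglongrightarrow> - v"
      using tendsto_diff[OF LIMSEQ_subseq_LIMSEQ[OF d0 s(1)] s(2)] by (simp add: o_def)
  qed (rule s(1))
  then have v: "- v \<in> limiting_subdiff \<phi> y"
    using osc[OF y] py unfolding outer_semicontinuous_at_def by blast
  have phy: "\<phi> y = ereal (h y)" by (rule phi_real[OF y])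
  obtain \<delta> \<eta> where \<delta>: "\<delta> > 0" and pr: "\<forall>x u x'.
        x \<in> ball y \<delta> \<and> u \<in> limiting_subdiff \<phi> x \<inter> ball (- v) \<delta> \<and> \<phi> x < \<phi> y + ereal \<delta> \<and>
        x' \<in> ball y \<delta> \<longrightarrow>
        \<phi> x' \<ge> \<phi> x + ereal (u \<bullet> (x' - x)) - ereal (\<eta> / 2 * (norm (x' - x))\<^sup>2)"
    using prox_reg[OF y] v unfolding prox_regular_at_def prox_regular_at_for_def by blast
  \<comment> \<open>Prox-regularity is used with the base point \<open>y\<close> and the subgradient
    \<open>- v\<close> themselves; it then reads as a local quadratic support of
    \<open>\<phi>\<close> at \<open>y\<close>.\<close>
  have "- v \<in> frechet_subdiff \<phi> y"
  proof (rule frechet_subdiff_quadraticI[of \<phi>, OF phy \<delta>])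
    fix z assume "dist z y < \<delta>"
    moreover have "\<phi> y < \<phi> y + ereal \<delta>" using \<delta> by (subst (1 2) phy) simp
    ultimately have "\<phi> y + ereal (- v \<bullet> (z - y)) - ereal (\<eta> / 2 * (norm (z - y))\<^sup>2) \<le> \<phi> z"
      using pr[rule_format, of y "- v" z] v \<delta> by (simp add: dist_commute)
    then show "ereal (h y + - v \<bullet> (z - y) - \<eta> / 2 * (norm (z - y))\<^sup>2) \<le> \<phi> z"
      by (subst (asm) phy) simp
  qed
  then have "v + - v \<in> frechet_subdiff (\<lambda>y. F y + \<phi> y) y"
    by (intro frechet_subdiff_add[of F _ _ \<phi>, OF F_real[OF yD] phy] vF)
  then show ?thesis using y by (simp add: frechet_stationary_def)
qed

end

theorem theorem5p3:
  fixes F \<phi> :: "'a::euclidean_space \<Rightarrow> ereal"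
    and Fs :: "real \<Rightarrow> 'a \<Rightarrow> ereal"
    and g\<phi> mt :: ereal
    and \<kappa> w1 w2 c \<rho> ginit \<theta> \<beta> :: real
    and \<mu> \<gamma> R Rh :: "nat \<Rightarrow> real"
    and x :: "nat \<Rightarrow> 'a"
    and M :: "nat \<Rightarrow> ereal"
    and chi :: ereal
  assumes "proper_fun F" and "lsc_fun F"
    and "proper_fun \<phi>" and "lsc_fun \<phi>"
    and "(INF y. F y + \<phi> y) > -\<infinity>"
    and "\<forall>y\<in>interior (edom F). locally_lipschitz_at F y"
    and "convex (edom F)" and "edom \<phi> \<subseteq> interior (edom F)"
    and "0 < g\<phi>" and "prox_bounded \<phi> g\<phi>"
    and "\<forall>y\<in>interior (edom F). lower_regular_at F y"
    and "\<forall>y\<in>edom \<phi>. prox_regular_at \<phi> y"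
    and "0 < mt" and "smoothing_function F mt Fs \<kappa> w1 w2"
    and "x 1 \<in> edom \<phi>"
    and "0 < c" and "c < 1 / 2"
    and "0 < \<rho>" and "\<rho> < 1"
    and "0 < ginit" and "ereal ginit < g\<phi>"
    and "0 < \<theta>" and "\<theta> < 1"
    and "\<forall>n\<ge>1. 0 < \<mu> n \<and> ereal (\<mu> n) < mt"
    and "antimono_on {1..} \<mu>" and "\<mu> \<longlonglongrightarrow> 0"
    and "filterlim (\<lambda>N. \<Sum>n=1..N. \<mu> n) at_top sequentially"
    and "prox_variable_smoothing_run \<phi> Fs \<kappa> c \<rho> ginit \<theta> \<mu> x \<gamma> R"
  defines "M \<equiv> \<lambda>n. stationarity_measure (\<gamma> n) (Fs (\<mu> n)) \<phi> (x n)"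
    and "Rh \<equiv> \<lambda>n. R n + \<kappa> * \<mu> n"
    and "\<beta> \<equiv> min (ginit * (w1 + w2 * inverse (\<mu> 1))) (\<rho> * (1 - 2 * c))"
    and "chi \<equiv> (F (x 1) + \<phi> (x 1) + ereal (\<kappa> * \<mu> 1) - (INF y. F y + \<phi> y))
                  * ereal (w1 + inverse (\<mu> 1) * w2) / ereal (\<theta> * c * \<beta> * inverse (\<mu> 1))"
  shows
    "(\<forall>n\<ge>1.
        ereal (Rh n - Rh (n + 1)) \<ge> ereal (\<theta> * c * \<gamma> n) * (M n)\<^sup>2 \<and>
        ereal (\<theta> * c * \<gamma> n) * (M n)\<^sup>2 \<ge> 0 \<and>
        ereal (Rh n) \<ge> F (x n) + \<phi> (x n) \<and>
        F (x n) + \<phi> (x n) \<ge> (INF y. F y + \<phi> y) \<and>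
        (INF y. F y + \<phi> y) > -\<infinity> \<and>
        x n \<in> {y. F y + \<phi> y \<le> ereal (Rh 1)} \<and>
        {y. F y + \<phi> y \<le> ereal (Rh 1)} \<subseteq> edom \<phi>)
     \<and>
     0 < \<beta> \<and> 0 < chi \<and> chi < \<infinity> \<and>
     (\<forall>k1 k2. 1 \<le> k1 \<and> k1 \<le> k2 \<longrightarrow>
        (\<Sum>n=k1..k2. ereal (\<mu> n) * (M n)\<^sup>2) \<le> chi \<and>
        Min (M ` {k1..k2}) \<le> ereal (sqrt (real_of_ereal chi / (\<Sum>n=k1..k2. \<mu> n)))) \<and>
     (\<forall>\<tau> \<alpha>. 0 < \<tau> \<and> ereal \<tau> < mt \<and> 1 < \<alpha> \<and> (\<forall>n\<ge>1. \<mu> n = \<tau> * real n powr (- 1 / \<alpha>)) \<longrightarrow>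
        (\<forall>k\<ge>1. Min (M ` {1..k}) < \<infinity>) \<and>
        (\<lambda>k. real_of_ereal (Min (M ` {1..k}))) \<in> O(\<lambda>k. real k powr (- (\<alpha> - 1) / (2 * \<alpha>))))
     \<and>
     liminf M = 0 \<and>
     (\<forall>m::nat \<Rightarrow> nat. strict_mono_on {1..} m \<and> (\<forall>l\<ge>1. 1 \<le> m l) \<and> (\<lambda>l. M (m l)) \<longlonglongrightarrow> 0 \<longrightarrow>
        (\<forall>xb. cluster_point_of_seq (\<lambda>l. x (m l)) xb \<longrightarrow>
           xb \<in> edom \<phi> \<and>
           ((\<forall>y\<in>edom \<phi>. outer_semicontinuous_at (limiting_subdiff \<phi>) y) \<longrightarrow>
              frechet_stationary F \<phi> xb)))"
proof -
  interpret smoothing F mt Fs \<kappa> w1 w2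
    using assms(1,7,14) by unfold_locales (simp_all add: proper_fun_def)
  interpret smoothing_run F mt Fs \<kappa> w1 w2 \<phi> c \<rho> ginit \<theta> \<mu> \<gamma> R x
    using assms by unfold_locales auto
  have lower: "(INF y. F y + \<phi> y) \<le> F z + \<phi> z" for z by (rule INF_lower) simp
  have part_a: "\<forall>n\<ge>1.
        ereal (Rh n - Rh (n + 1)) \<ge> ereal (\<theta> * c * \<gamma> n) * (M n)\<^sup>2 \<and>
        ereal (\<theta> * c * \<gamma> n) * (M n)\<^sup>2 \<ge> 0 \<and>
        ereal (Rh n) \<ge> F (x n) + \<phi> (x n) \<and>
        F (x n) + \<phi> (x n) \<ge> (INF y. F y + \<phi> y) \<and>
        (INF y. F y + \<phi> y) > -\<infinity> \<and>
        x n \<in> {y. F y + \<phi> y \<le> ereal (Rh 1)} \<and>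
        {y. F y + \<phi> y \<le> ereal (Rh 1)} \<subseteq> edom \<phi>"
    unfolding M_def Rh_def
    using Rhat_decrease_M Rhat_ge lower bounded_below iterate_in_sublevel sublevel_subset
      \<theta> c stepsize_pos
    by (simp add: M_square_real less_imp_le)
  have chi: "chi = ereal chi_val"
    unfolding chi_def \<beta>_def by (rule chi_eq)
  have part_b: "\<forall>k1 k2. 1 \<le> k1 \<and> k1 \<le> k2 \<longrightarrow>
        (\<Sum>n=k1..k2. ereal (\<mu> n) * (M n)\<^sup>2) \<le> chi \<and>
        Min (M ` {k1..k2}) \<le> ereal (sqrt (real_of_ereal chi / (\<Sum>n=k1..k2. \<mu> n)))"
  proof (intro allI impI conjI; elim conjE)
    fix k1 k2 :: nat assume k: "1 \<le> k1" "k1 \<le> k2"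
    show "(\<Sum>n=k1..k2. ereal (\<mu> n) * (M n)\<^sup>2) \<le> chi"
      unfolding chi M_def ereal_sum_M[OF k(1)] using sum_M_le[OF k] by simp
    show "Min (M ` {k1..k2}) \<le> ereal (sqrt (real_of_ereal chi / (\<Sum>n=k1..k2. \<mu> n)))"
      unfolding chi M_def Min_M_real[OF k] using Min_Mr_le[OF k] by simp
  qed
  have part_b': "\<forall>\<tau> \<alpha>. 0 < \<tau> \<and> ereal \<tau> < mt \<and> 1 < \<alpha> \<and> (\<forall>n\<ge>1. \<mu> n = \<tau> * real n powr (- 1 / \<alpha>)) \<longrightarrow>
        (\<forall>k\<ge>1. Min (M ` {1..k}) < \<infinity>) \<and>
        (\<lambda>k. real_of_ereal (Min (M ` {1..k}))) \<in> O(\<lambda>k. real k powr (- (\<alpha> - 1) / (2 * \<alpha>)))"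
  proof (intro allI impI; elim conjE; intro conjI allI impI)
    fix \<tau> \<alpha> :: real assume "0 < \<tau>" "1 < \<alpha>" "\<forall>n\<ge>1. \<mu> n = \<tau> * real n powr (- 1 / \<alpha>)"
    then show "(\<lambda>k. real_of_ereal (Min (M ` {1..k}))) \<in> O(\<lambda>k. real k powr (- (\<alpha> - 1) / (2 * \<alpha>)))"
      unfolding M_def by (intro Min_M_bigo) auto
    \<comment> \<open>\<open>real_of_ereal\<close> sends infinity to 0, so the rate by itself would
      not exclude infinite minima; finiteness is shown separately.\<close>
    show "Min (M ` {1..k}) < \<infinity>" if "1 \<le> k" for k
      unfolding M_def Min_M_real[OF order_refl that] by simp
  qed
  have part_c: "xb \<in> edom \<phi> \<and>
       ((\<forall>y\<in>edom \<phi>. outer_semicontinuous_at (limiting_subdiff \<phi>) y) \<longrightarrow> frechet_stationary F \<phi> xb)"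
    if m: "strict_mono_on {1..} m" "\<forall>l\<ge>1. 1 \<le> m l" "(\<lambda>l. M (m l)) \<longlonglongrightarrow> 0"
      and cl: "cluster_point_of_seq (\<lambda>l. x (m l)) xb" for m :: "nat \<Rightarrow> nat" and xb
  proof -
    obtain r where r: "strict_mono r" "(\<lambda>k. x (m (r k))) \<longlonglongrightarrow> xb"
      using cl unfolding cluster_point_of_seq_def by blast
    \<comment> \<open>\<open>m\<close> is controlled only from index 1 on, and \<open>r 0\<close>
      may be 0; the shift drops this entry without changing the limits.\<close>
    let ?r = "\<lambda>k. r (Suc k)"
    have r': "strict_mono ?r" using r(1) by (simp add: strict_mono_def)
    have r1: "1 \<le> ?r k" for k using seq_suble[OF r(1), of "Suc k"] by simp
    have n: "strict_mono (\<lambda>k. m (?r k))" "\<And>k. 1 \<le> m (?r k)"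
      using m(1,2) r1 r' by (auto simp: strict_mono_def monotone_on_def)
    have lim: "(\<lambda>k. x (m (?r k))) \<longlonglongrightarrow> xb" by (rule LIMSEQ_Suc[OF r(2)])
    have M0: "(\<lambda>k. M (m (?r k))) \<longlonglongrightarrow> 0"
      using LIMSEQ_subseq_LIMSEQ[OF m(3) r'] by (simp add: o_def)
    have xb: "xb \<in> edom \<phi>" by (rule cluster_point_in_edom[OF assms(2,4) n(2) lim])
    then show ?thesis
      using cluster_point_stationary[OF _ _ _ _ assms(26) n M0[unfolded M_def] lim xb] assms(6,11,12) by blast
  qed
  have "0 < \<beta>" unfolding \<beta>_def by (rule \<beta>_pos)
  moreover have "0 < chi" "chi < \<infinity>" unfolding chi using chi_val_pos by simp_all
  moreover have "liminf M = 0" unfolding M_def by (rule liminf_M[OF assms(27)])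
  moreover have "\<forall>m::nat \<Rightarrow> nat. strict_mono_on {1..} m \<and> (\<forall>l\<ge>1. 1 \<le> m l) \<and> (\<lambda>l. M (m l)) \<longlonglongrightarrow> 0 \<longrightarrow>
        (\<forall>xb. cluster_point_of_seq (\<lambda>l. x (m l)) xb \<longrightarrow>
           xb \<in> edom \<phi> \<and>
           ((\<forall>y\<in>edom \<phi>. outer_semicontinuous_at (limiting_subdiff \<phi>) y) \<longrightarrow>
              frechet_stationary F \<phi> xb))"
    using part_c by blast
  ultimately show ?thesis
    by (intro conjI part_a part_b part_b')
qed

end
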